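(* For an odd integer $R\geq 3$, let $\alpha=\alpha(R)\in(0,1)$ be given by the purely periodic negative continued fraction expansion $$\alpha=[0;\overline{R,R,R+1,R,R+1,R+1,R,R+1,R+1,R,R+1}]^-.$$ Then, as $R\to\infty$ through odd integers, $$\rho(\alpha)=\frac14\left(1-\frac{3}{R}+\frac{4}{R^2}+O\!\left(R^{-3}\right)\right).$$
   Context: For real $x$, $\|x\|$ denotes the distance from $x$ to the nearest integer. For irrational $\alpha$ and real $\gamma$, $M(\alpha,\gamma):=\liminf_{|n|\to\infty}|n|\,\|n\alpha-\gamma\|$, and $\rho(\alpha):=\sup_{\gamma\notin\mathbb{Z}+\alpha\mathbb{Z}}M(\alpha,\gamma)$. The negative continued fraction expansion $[0;a_1,a_2,\ldots]^-$ means $\alpha=\cfrac{1}{a_1-\cfrac{1}{a_2-\cdots}}$ with integers $a_i\geq2$ generated by $\alpha_0=\alpha$, $a_{n+1}=\lceil 1/\alpha_n\rceil$, $\alpha_{n+1}=\lceil1/\alpha_n\rceil-1/\alpha_n$; an overline denotes the repeating block. *)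

theory Defs
  imports "HOL-Analysis.Analysis"
begin

definition dnint :: "real \<Rightarrow> real" where
  "dnint x = \<bar>x - of_int (round x)\<bar>"

definition Mval :: "real \<Rightarrow> real \<Rightarrow> ereal" where
  "Mval \<alpha> \<gamma> = Liminf (cofinite :: int filter)
      (\<lambda>n. ereal (\<bar>real_of_int n\<bar> * dnint (real_of_int n * \<alpha> - \<gamma>)))"

definition rho :: "real \<Rightarrow> ereal" where
  "rho \<alpha> = (SUP \<gamma>\<in>{\<gamma>. \<not> (\<exists>a b::int. \<gamma> = of_int a + of_int b * \<alpha>)}. Mval \<alpha> \<gamma>)"

text \<open>Negative continued fraction algorithm: ncf_rem alpha n = alpha_n,
  ncf_digit alpha n = a_(n+1) = ceiling(1/alpha_n).\<close>
primrec ncf_rem :: "real \<Rightarrow> nat \<Rightarrow> real" where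
  "ncf_rem \<alpha> 0 = \<alpha>"
| "ncf_rem \<alpha> (Suc n) = of_int (ceiling (1 / ncf_rem \<alpha> n)) - 1 / ncf_rem \<alpha> n"

definition ncf_digit :: "real \<Rightarrow> nat \<Rightarrow> int" where
  "ncf_digit \<alpha> n = ceiling (1 / ncf_rem \<alpha> n)"

definition period_block :: "int \<Rightarrow> int list" where
  "period_block R = [R, R, R+1, R, R+1, R+1, R, R+1, R+1, R, R+1]"

end

(*
Write a grid point (n, n alpha - m - gamma) in the basis of the lattice given by two consecutive
convergents, relative to the centre of the k-th divided cell: its coordinates are then half odd
integers (M, N) shifted by small quantities x, -z, and
  4 |n (n alpha - m - gamma)| (1 - u v) = |x + M + N u| |-z + M v + N|
with u, v = 1/R + O(1/R^2). The shift gamma is encoded by integers s_k of the same parity as the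
digits, with x_(k+1) = u_(k+1) (s_k + x_k) and z_k = v_k (s_k + z_(k+1)). Expanding the products at
the two vertices (M, N) = (1, -1), (-1, 1) in e = 1/R gives
  1 - (2 + |s_(k-1) + s_k|) e + O(e^2)
for the smaller one. In the upper bound this forces |s_(k-1) + s_k| <= 1, with equality wherever an
odd and an even digit are adjacent, and there the coefficient of e^2 is an integer depending on
s_(k-2), ..., s_(k+1). A finite search over one period shows that it cannot always exceed 4,
whereas for one explicit periodic sequence it is always at least 4.
*)
theory Submission
  imports Defs
begin

section \<open>Expansions in the reciprocal of R\<close>

text \<open>The obstacle in the upper bound is that for arbitrary gamma the integers s_k may be of
  size R, so nothing can be expanded in e before they are bounded independently of R. Three passes
  over the same two vertex inequalities achieve this. Their product gives x^2, z^2 = O(e), which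
  still allows s_k of order sqrt R. Their common linear part then bounds |s_(k-1) + s_k|. Finally,
  where this sum is 1 or -1, a large s_k makes x z about -(e s_k)^2, a loss that error terms of
  order e^2 |s_k| cannot repay. Where adjacent digits have equal parity the sum is even, hence 0,
  and both vertex products exceed the target already at order e; only mixed pairs give second order
  conditions. Error constants are explicit because they must be uniform in k, gamma and R. The
  300000 in the final bounds is more than twice the 130000 of the vertex expansion, since it is
  multiplied by 1 - u v, which is only estimated below by 1/2.\<close>

definition approx2 :: "real \<Rightarrow> real \<Rightarrow> real \<Rightarrow> real \<Rightarrow> real \<Rightarrow> real \<Rightarrow> bool" where
  "approx2 e K A a0 a1 a2 \<longleftrightarrow> \<bar>A - (a0 + a1 * e + a2 * e^2)\<bar> \<le> K * e^3"

lemma approx2_diff: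
  assumes "approx2 e K A a0 a1 a2" "approx2 e L B b0 b1 b2"
  shows "approx2 e (K + L) (A - B) (a0 - b0) (a1 - b1) (a2 - b2)"
  using assms unfolding approx2_def by (simp add: algebra_simps abs_le_iff)

lemma approx2_scale:
  assumes "approx2 e K A a0 a1 a2" "\<bar>c\<bar> = 1"
  shows "approx2 e K (c * A) (c * a0) (c * a1) (c * a2)"
proof -
  have "c * A - (c * a0 + c * a1 * e + c * a2 * e^2) = c * (A - (a0 + a1 * e + a2 * e^2))"
    by (simp add: algebra_simps)
  thus ?thesis using assms unfolding approx2_def by (simp add: abs_mult)
qed

lemma approx2_poly: "approx2 e 0 (a0 + a1 * e + a2 * e^2) a0 a1 a2"
  by (simp add: approx2_def)

lemma approx2_mult:
  assumes e: "0 < e" "e \<le> 1"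
    and A: "approx2 e K A a0 a1 a2" and B: "approx2 e L B b0 b1 b2"
    and a: "\<bar>a0\<bar> \<le> S" "\<bar>a1\<bar> \<le> S" "\<bar>a2\<bar> \<le> S"
    and b: "\<bar>b0\<bar> \<le> T" "\<bar>b1\<bar> \<le> T" "\<bar>b2\<bar> \<le> T" and L: "0 \<le> L"
  shows "approx2 e (K * (3 * T + L) + 3 * S * L + 3 * S * T) (A * B)
    (a0 * b0) (a0 * b1 + a1 * b0) (a0 * b2 + a1 * b1 + a2 * b0)"
proof -
  define f where "f = a0 + a1 * e + a2 * e^2"
  define g where "g = b0 + b1 * e + b2 * e^2"
  have e2: "0 \<le> e^2" "e^2 \<le> 1" and e3: "0 \<le> e^3" "e^3 \<le> 1" using e by (auto simp: power_le_one)
  have S: "0 \<le> S" and T: "0 \<le> T" using a b by linarith+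
  have f: "\<bar>f\<bar> \<le> 3 * S"
  proof -
    have "\<bar>a1 * e\<bar> \<le> S * 1" "\<bar>a2 * e^2\<bar> \<le> S * 1"
      unfolding abs_mult using a e e2 S by (intro mult_mono; simp)+
    thus ?thesis using a(1) unfolding f_def by linarith
  qed
  have g: "\<bar>g\<bar> \<le> 3 * T"
  proof -
    have "\<bar>b1 * e\<bar> \<le> T * 1" "\<bar>b2 * e^2\<bar> \<le> T * 1"
      unfolding abs_mult using b e e2 T by (intro mult_mono; simp)+
    thus ?thesis using b(1) unfolding g_def by linarith
  qed
  have Ae: "\<bar>A - f\<bar> \<le> K * e^3" and Be: "\<bar>B - g\<bar> \<le> L * e^3"
    using A B unfolding approx2_def f_def g_def by auto
  have "L * e^3 \<le> L * 1" using L e3 by (intro mult_left_mono)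
  hence Bb: "\<bar>B\<bar> \<le> 3 * T + L" using Be g by linarith
  have K0: "0 \<le> K * e^3" using Ae by linarith
  have t1: "\<bar>(A - f) * B\<bar> \<le> K * e^3 * (3 * T + L)"
    unfolding abs_mult using Ae Bb K0 by (intro mult_mono) auto
  have t2: "\<bar>f * (B - g)\<bar> \<le> 3 * S * (L * e^3)"
    unfolding abs_mult using f Be S by (intro mult_mono) auto
  have t3: "\<bar>e^3 * (a1 * b2 + a2 * b1 + e * (a2 * b2))\<bar> \<le> e^3 * (3 * S * T)"
  proof -
    have "\<bar>a1 * b2\<bar> \<le> S * T" "\<bar>a2 * b1\<bar> \<le> S * T" "\<bar>a2 * b2\<bar> \<le> S * T"
      unfolding abs_mult using a b S by (intro mult_mono; simp)+
    moreover have "\<bar>e * (a2 * b2)\<bar> \<le> 1 * (S * T)"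
      unfolding abs_mult[of e] using e calculation(3) by (intro mult_mono) auto
    ultimately have "\<bar>a1 * b2 + a2 * b1 + e * (a2 * b2)\<bar> \<le> 3 * S * T" by linarith
    thus ?thesis unfolding abs_mult[of "e^3"] using e3 by (intro mult_mono) auto
  qed
  \<comment> \<open>The polynomial part f g exceeds its truncation exactly by the terms of degree 3
    and 4.\<close>
  have "A * B - (a0 * b0 + (a0 * b1 + a1 * b0) * e + (a0 * b2 + a1 * b1 + a2 * b0) * e^2)
     = (A - f) * B + f * (B - g) + e^3 * (a1 * b2 + a2 * b1 + e * (a2 * b2))"
    unfolding f_def g_def by algebra
  hence "\<bar>A * B - (a0 * b0 + (a0 * b1 + a1 * b0) * e + (a0 * b2 + a1 * b1 + a2 * b0) * e^2)\<bar>
     \<le> K * e^3 * (3 * T + L) + 3 * S * (L * e^3) + e^3 * (3 * S * T)"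
    using t1 t2 t3 by linarith
  thus ?thesis unfolding approx2_def by (simp add: algebra_simps)
qed

lemma approx2_mono: "approx2 e K A a0 a1 a2 \<Longrightarrow> 0 < e \<Longrightarrow> K \<le> L \<Longrightarrow> approx2 e L A a0 a1 a2"
  unfolding approx2_def by (erule order_trans) (intro mult_right_mono, auto)

text \<open>One step of the recursion for x or z. Since u is itself O(e), a first order expansion of
  the neighbour x' is enough. The constant 220 covers 5 * 21 + 90 + 20.\<close>

lemma approx2_centre:
  fixes e u x' p s d :: real
  assumes e: "0 < e" "e \<le> 1/1000000" and u: "\<bar>u - (e - d * e^2)\<bar> \<le> 5 * e^3"
    and d: "0 \<le> d" "d \<le> 1" and p: "\<bar>p\<bar> \<le> 20" and s: "\<bar>s\<bar> \<le> 20"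
    and x': "\<bar>x' - e * s\<bar> \<le> 90 * e^2"
  shows "approx2 e 220 (u * (p + x')) 0 p (s - d * p)"
proof -
  have e2: "e^2 \<le> e * (1/1000000)" using e unfolding power2_eq_square by (intro mult_left_mono) auto
  have "\<bar>e * s\<bar> \<le> e * 20" unfolding abs_mult using e s by (intro mult_mono) auto
  hence b1: "\<bar>p + x'\<bar> \<le> 21" using p x' e2 e by linarith
  have "d * e^2 \<le> 1 * e^2" using d by (intro mult_right_mono) auto
  moreover have "0 \<le> d * e^2" using d by simp
  ultimately have b2: "\<bar>e - d * e^2\<bar> \<le> e" using e2 e by linarith
  have t1: "\<bar>(u - (e - d * e^2)) * (p + x')\<bar> \<le> 5 * e^3 * 21"
    unfolding abs_mult using u b1 e by (intro mult_mono) auto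
  have t2: "\<bar>(e - d * e^2) * (x' - e * s)\<bar> \<le> e * (90 * e^2)"
    unfolding abs_mult using b2 x' e by (intro mult_mono) auto
  have t3: "\<bar>d * s * e^3\<bar> \<le> (1 * 20) * e^3"
    unfolding abs_mult using d s e by (intro mult_mono) auto
  have eq: "u * (p + x') - (0 + p * e + (s - d * p) * e^2)
    = (u - (e - d * e^2)) * (p + x') + (e - d * e^2) * (x' - e * s) - d * s * e^3"
    by algebra
  have "e * (90 * e^2) = 90 * e^3" by (simp add: power2_eq_square power3_eq_cube)
  thus ?thesis unfolding approx2_def eq using t1 t2 t3 e zero_le_power[of e 3] by linarith
qed

text \<open>The sign c selects the vertex: c = 1 is (M, N) = (-1, 1) and c = -1 is (1, -1). The
  target carries the area factor 1 - u v, hence is 1 - 3 e + 3 e^2 + O(e^3). The difference begins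
  at order e^2 precisely when c (p + q) = 1.\<close>

lemma cell_expand:
  fixes e u v x z p q s2 s1 d1 d2 c :: real
  assumes e: "0 < e" "e \<le> 1/1000000"
    and u: "\<bar>u - (e - d1 * e^2)\<bar> \<le> 5 * e^3" and v: "\<bar>v - (e - d2 * e^2)\<bar> \<le> 5 * e^3"
    and d: "0 \<le> d1" "d1 \<le> 1" "0 \<le> d2" "d2 \<le> 1"
    and b: "\<bar>p\<bar> \<le> 20" "\<bar>q\<bar> \<le> 20" "\<bar>s2\<bar> \<le> 20" "\<bar>s1\<bar> \<le> 20"
    and x: "approx2 e 220 x 0 p (s2 - d1 * p)" and z: "approx2 e 220 z 0 q (s1 - d2 * q)"
    and c: "c = 1 \<or> c = -1"
  shows "\<bar>(1 - u - c * x) * (1 - v - c * z) - (1 - 3 * e + 4 * e^2) * (1 - u * v)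
    - (e * (1 - c * (p + q)) + e^2 * (d1 + d2 - 2 + p * q + c * (p + q) - c * (s2 + s1 - d1 * p - d2 * q)))\<bar>
    \<le> 130000 * e^3"
proof -
  have c1: "\<bar>c\<bar> = 1" "c * c = 1" using c by auto
  have dp: "\<bar>d1 * p\<bar> \<le> 1 * 20" "\<bar>d2 * q\<bar> \<le> 1 * 20"
    unfolding abs_mult using d b by (intro mult_mono; simp)+
  have ua: "approx2 e 5 u 0 1 (- d1)" and va: "approx2 e 5 v 0 1 (- d2)"
    using u v unfolding approx2_def by (simp_all add: algebra_simps)
  have one: "approx2 e 0 1 1 0 0" unfolding approx2_def by simp
  have P: "approx2 e 225 (1 - u - c * x) 1 (-1 - c * p) (d1 - c * (s2 - d1 * p))"
    using approx2_diff[OF approx2_diff[OF one ua] approx2_scale[OF x c1(1)]] by (simp add: algebra_simps)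
  have Q: "approx2 e 225 (1 - v - c * z) 1 (-1 - c * q) (d2 - c * (s1 - d2 * q))"
    using approx2_diff[OF approx2_diff[OF one va] approx2_scale[OF z c1(1)]] by (simp add: algebra_simps)
  \<comment> \<open>41 = 1 + 20 + 20 bounds the largest coefficient, the one of e^2.\<close>
  have bP: "\<bar>1::real\<bar> \<le> 41" "\<bar>-1 - c * p\<bar> \<le> 41" "\<bar>d1 - c * (s2 - d1 * p)\<bar> \<le> 41"
    and bQ: "\<bar>-1 - c * q\<bar> \<le> 41" "\<bar>d2 - c * (s1 - d2 * q)\<bar> \<le> 41"
    using c b d dp by auto
  have e1: "e \<le> 1" using e by simp
  have PQ: "approx2 e 111018 ((1 - u - c * x) * (1 - v - c * z)) 1 (-2 - c * (p + q))
      (d1 + d2 + 1 + c * (p + q) + p * q - c * (s2 + s1 - d1 * p - d2 * q))"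
  proof -
    have cc: "c * (c * w) = w" for w using c1 by (simp flip: mult.assoc)
    show ?thesis
      using approx2_mult[OF e(1) e1 P Q bP bP(1) bQ] by (simp add: algebra_simps cc)
  qed
  have uv: "approx2 e 58 (u * v) 0 0 1"
    using approx2_mult[OF e(1) e1 ua va, of 1 1] d by simp
  have "approx2 e 58 (1 - u * v) 1 0 (-1)"
    using approx2_diff[OF one uv] by simp
  from approx2_mult[OF e(1) e1 approx2_poly[of e 1 "-3" 4] this, of 4 1]
  have "approx2 e 708 ((1 - 3 * e + 4 * e^2) * (1 - u * v)) 1 (-3) 3" by simp
  from approx2_mono[OF approx2_diff[OF PQ this] e(1), of 130000]
  show ?thesis unfolding approx2_def by (simp add: algebra_simps)
qed

section \<open>A priori estimates from a pair of opposite vertices\<close>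

lemma vertex_bounds_imp_small:
  fixes e u v x z r :: real
  assumes e: "0 < e" "e \<le> 1/1000000"
    and u: "0 < u" "u \<le> 2 * e" and v: "0 < v" "v \<le> 2 * e"
    and x: "\<bar>x\<bar> \<le> 1 + 8 * e" and z: "\<bar>z\<bar> \<le> 1" and r: "1 - 3 * e \<le> r"
    and h1: "r * (1 - u * v) \<le> \<bar>1 - u + x\<bar> * \<bar>1 - v + z\<bar>"
    and h2: "r * (1 - u * v) \<le> \<bar>1 - u - x\<bar> * \<bar>1 - v - z\<bar>"
  shows "x^2 \<le> 8 * e" "z^2 \<le> 8 * e"
proof -
  have e2: "e * e \<le> e * (1/1000000)" using e by (intro mult_left_mono) auto
  have uv: "u * v \<le> 2 * e * (2 * e)" using e u v by (intro mult_mono) auto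
  have uv0: "0 < u * v" using u v by simp
  \<comment> \<open>Multiplying the hypotheses groups the factors as |P| |S|. Neither exceeds 1, so
    each is at least 1 - 7 e; the lower bounds on P and S rule out negative signs.\<close>
  define P where "P = (1 - u)^2 - x^2"
  define S where "S = (1 - v)^2 - z^2"
  have u1: "1 - 4 * e \<le> (1 - u)^2" "(1 - u)^2 \<le> 1" and v1: "1 - 4 * e \<le> (1 - v)^2" "(1 - v)^2 \<le> 1"
  proof -
    have "(1 - u)^2 = 1 - 2 * u + u^2" "(1 - v)^2 = 1 - 2 * v + v^2"
      by (simp_all add: power2_eq_square algebra_simps)
    thus "1 - 4 * e \<le> (1 - u)^2" "1 - 4 * e \<le> (1 - v)^2"
      using u v zero_le_power2[of u] zero_le_power2[of v] by linarith+
    show "(1 - u)^2 \<le> 1" "(1 - v)^2 \<le> 1" using u v e by (auto intro!: power_le_one)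
  qed
  have x2: "x^2 \<le> 1 + 17 * e"
  proof -
    have "x^2 \<le> (1 + 8 * e)^2" using x e by (metis abs_ge_zero power2_abs power_mono)
    also have "\<dots> = 1 + 16 * e + 64 * (e * e)" by (simp add: power2_eq_square algebra_simps)
    finally show ?thesis using e2 e by linarith
  qed
  have z2: "z^2 \<le> 1" using z by (simp add: abs_square_le_1)
  have x20: "0 \<le> x^2" "0 \<le> z^2" by auto
  have Pb: "\<bar>P\<bar> \<le> 1" "P \<ge> - 21 * e" using u1 x2 x20 e unfolding P_def by linarith+
  have Sb: "\<bar>S\<bar> \<le> 1" "S \<ge> - 4 * e" using v1 z2 x20 e unfolding S_def by linarith+
  have w0: "1 - 32/10 * e \<le> r * (1 - u * v)"
  proof -
    have "(1 - 3 * e) * (1 - u * v) \<le> r * (1 - u * v)"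
      using r uv e2 e by (intro mult_right_mono; linarith)
    moreover have "(1 - 3 * e) * (1 - u * v) = 1 - 3 * e - u * v + 3 * e * (u * v)" by algebra
    moreover have "0 \<le> 3 * e * (u * v)" using e uv0 by auto
    ultimately show ?thesis using uv uv0 e2 e by linarith
  qed
  have w0': "0 \<le> r * (1 - u * v)" using w0 e by linarith
  have "(1 - 32/10 * e) * (1 - 32/10 * e) \<le> (r * (1 - u * v)) * (r * (1 - u * v))"
    using w0 e w0' by (intro mult_mono) auto
  also have "\<dots> \<le> (\<bar>1 - u + x\<bar> * \<bar>1 - v + z\<bar>) * (\<bar>1 - u - x\<bar> * \<bar>1 - v - z\<bar>)"
    by (rule mult_mono[OF h1 h2 _ w0']) simp
  also have "\<dots> = \<bar>P\<bar> * \<bar>S\<bar>"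
  proof -
    have "P = (1 - u + x) * (1 - u - x)" "S = (1 - v + z) * (1 - v - z)"
      unfolding P_def S_def by (simp_all add: algebra_simps power2_eq_square)
    thus ?thesis by (simp add: abs_mult)
  qed
  finally have PS: "1 - 7 * e \<le> \<bar>P\<bar> * \<bar>S\<bar>"
    using mult_pos_pos[OF e(1) e(1)] e unfolding left_diff_distrib right_diff_distrib by linarith
  have "\<bar>P\<bar> * \<bar>S\<bar> \<le> \<bar>P\<bar> * 1" "\<bar>P\<bar> * \<bar>S\<bar> \<le> 1 * \<bar>S\<bar>"
    using Pb Sb by (intro mult_left_mono mult_right_mono; simp)+
  hence "1 - 7 * e \<le> P" "1 - 7 * e \<le> S" using PS Pb Sb e by linarith+
  thus "x^2 \<le> 8 * e" "z^2 \<le> 8 * e" using u1 v1 e unfolding P_def S_def by linarith+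
qed

text \<open>The two products differ only in the sign of the linear form x (1 - v) + z (1 - u), so
  together they limit its absolute value. The term x z is kept with its sign, because a negative x z
  sharpens the bound later.\<close>

lemma vertex_bounds_imp_linear:
  fixes e u v x z r :: real
  assumes e: "0 < e" "e \<le> 1/1000000"
    and u: "0 < u" "\<bar>u - e\<bar> \<le> 2 * e^2" and v: "0 < v" "\<bar>v - e\<bar> \<le> 2 * e^2"
    and r: "1 - 3 * e \<le> r"
    and h1: "r * (1 - u * v) \<le> (1 - u + x) * (1 - v + z)"
    and h2: "r * (1 - u * v) \<le> (1 - u - x) * (1 - v - z)"
  shows "\<bar>x * (1 - v) + z * (1 - u)\<bar> \<le> e + 7 * e^2 + x * z"
proof -
  have e2: "e^2 \<le> e * (1/1000000)" using e unfolding power2_eq_square by (intro mult_left_mono) auto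
  have ub: "u \<le> 11/10 * e" and vb: "v \<le> 11/10 * e" using u v e2 e by linarith+
  have "u * v \<le> (11/10 * e) * (11/10 * e)" using ub vb u v e by (intro mult_mono) auto
  hence uv: "u * v \<le> 13/10 * e^2" "0 < u * v"
    using u v e by (auto simp: power2_eq_square intro: order_trans)
  have "13/10 * e^2 \<le> 1" using e2 e by linarith
  hence m: "(1 - 3 * e) * (1 - u * v) \<le> r * (1 - u * v)"
    using r uv by (intro mult_right_mono) auto
  have m': "(1 - 3 * e) * (1 - u * v) = 1 - 3 * e - u * v + 3 * e * (u * v)" by algebra
  have pos: "0 \<le> 3 * e * (u * v)" using e uv by auto
  have f1: "(1 - u + x) * (1 - v + z) = 1 - u - v + u * v + x * z + (x * (1 - v) + z * (1 - u))"
    by algebra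
  have f2: "(1 - u - x) * (1 - v - z) = 1 - u - v + u * v + x * z - (x * (1 - v) + z * (1 - u))"
    by algebra
  show ?thesis
    using h1[unfolded f1] h2[unfolded f2] m[unfolded m'] pos uv u v
    unfolding abs_le_iff by linarith
qed

text \<open>For integers p, q this means |p + q| <= 1. To leading order p + q is (x + z) / u, and
  the linear bound makes |x + z| at most about e; x' and z' contribute at most sqrt (8 e)
  each.\<close>

lemma adjacent_sum_lt_2:
  fixes e u v x z x' z' p q :: real
  assumes e: "0 < e" "e \<le> 1/1000000"
    and u: "0 < u" "\<bar>u - e\<bar> \<le> 2 * e^2" and v: "0 < v" "\<bar>v - e\<bar> \<le> 2 * e^2"
    and L: "\<bar>x * (1 - v) + z * (1 - u)\<bar> \<le> e + 7 * e^2 + x * z"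
    and uv: "1 / u \<le> 1 / e + 1" "\<bar>1 / u - 1 / v\<bar> \<le> 2"
    and xz: "x^2 \<le> 8 * e" "z^2 \<le> 8 * e" and xz': "x'^2 \<le> 8 * e" "z'^2 \<le> 8 * e"
    and x: "x = u * (p + x')" and z: "z = v * (q + z')"
  shows "\<bar>p + q\<bar> < 2"
proof -
  have e2: "0 \<le> e^2" "e^2 \<le> e * (1/1000000)"
    using e unfolding power2_eq_square by (simp, intro mult_left_mono, auto)
  have small: "\<bar>y\<bar> \<le> 3/1000" if "y^2 \<le> 8 * e" for y :: real
  proof -
    have "y^2 \<le> (3/1000)^2" using that e by (simp add: power2_eq_square)
    thus ?thesis by (metis abs_le_square_iff abs_of_nonneg divide_nonneg_nonneg zero_le_numeral)
  qed
  note sm = small[OF xz(1)] small[OF xz(2)] small[OF xz'(1)] small[OF xz'(2)]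
  have ub: "u \<le> 11/10 * e" and vb: "v \<le> 11/10 * e" using u v e2 e by linarith+
  have xv: "\<bar>x * v\<bar> \<le> 3/1000 * (11/10 * e)" "\<bar>z * u\<bar> \<le> 3/1000 * (11/10 * e)"
    unfolding abs_mult using sm ub vb u v by (intro mult_mono; simp)+
  have L': "\<bar>(x + z) - x * v - z * u\<bar> \<le> e + 7 * e^2 + x * z" using L by (simp add: algebra_simps)
  have xz8: "x * z \<le> 8 * e"
    using sum_squares_bound[of x z] xz by linarith
  \<comment> \<open>The linear bound is used twice: if x and z have equal signs, each is at most |x
    + z| <= 10 e, which improves the crude bound 8 e to O(e^2).\<close>
  have xz_small: "x * z \<le> 1/100 * e"
  proof (cases "x * z > 0")
    case True
    have s: "\<bar>x + z\<bar> \<le> 10 * e" using L' xz8 xv e2 e by linarith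
    have "\<bar>x\<bar> \<le> 10 * e" "\<bar>z\<bar> \<le> 10 * e" using s True by (auto simp: zero_less_mult_iff)
    hence "\<bar>x\<bar> * \<bar>z\<bar> \<le> 10 * e * (10 * e)" by (intro mult_mono) auto
    hence "x * z \<le> 100 * e^2" using True abs_mult[of x z] by (simp add: power2_eq_square)
    thus ?thesis using e2 e by linarith
  qed (use e in linarith)
  have s: "\<bar>x + z\<bar> \<le> 102/100 * e" using L' xz_small xv e2 e by linarith
  have pq: "p + q = (x + z) * (1/u) + z * (1/v - 1/u) - x' - z'"
    using x z u v by (simp add: field_simps)
  have "\<bar>(x + z) * (1/u)\<bar> \<le> (102/100 * e) * (1/e + 1)"
    unfolding abs_mult using s uv(1) u e by (intro mult_mono) auto
  also have "\<dots> = 102/100 + 102/100 * e" using e by (simp add: field_simps)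
  finally have "\<bar>(x + z) * (1/u)\<bar> \<le> 103/100" using e by linarith
  moreover have "\<bar>z * (1/v - 1/u)\<bar> \<le> 3/1000 * 2"
    unfolding abs_mult using sm uv(2) by (intro mult_mono) (auto simp: abs_minus_commute)
  ultimately show ?thesis unfolding pq using sm by linarith
qed

text \<open>Here p is nearly -q, so x z is about -(e q)^2, while the linear form keeps size e up to
  O(e^2 |q|). Comparing both leaves 0.81 q^2 <= 12.2 |q| + 30, an inequality free of R.\<close>

lemma odd_adjacent_imp_bounded:
  fixes e u v x z x' z' p q :: real
  assumes e: "0 < e" "e \<le> 1/1000000"
    and u: "0 < u" "\<bar>u - e\<bar> \<le> 2 * e^2" and v: "0 < v" "\<bar>v - e\<bar> \<le> 2 * e^2"
    and L: "\<bar>x * (1 - v) + z * (1 - u)\<bar> \<le> e + 7 * e^2 + x * z"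
    and small: "\<bar>x'\<bar> \<le> 3/1000" "\<bar>z'\<bar> \<le> 3/1000"
    and x': "\<bar>x'\<bar> \<le> 2 * e * (\<bar>q\<bar> + 3)" and z': "\<bar>z'\<bar> \<le> 2 * e * (\<bar>q\<bar> + 3)"
    and x: "x = u * (p + x')" and z: "z = v * (q + z')" and pq: "\<bar>p + q\<bar> = 1"
  shows "\<bar>q\<bar> < 18"
proof -
  define m where "m = \<bar>q\<bar>"
  have m0: "0 \<le> m" by (simp add: m_def)
  have e2: "0 \<le> e^2" "e^2 \<le> e * (1/1000000)"
    using e unfolding power2_eq_square by (simp, intro mult_left_mono, auto)
  have pm: "\<bar>p\<bar> \<le> m + 1" using pq unfolding m_def by linarith
  have ub: "u \<le> 11/10 * e" "9/10 * e \<le> u" and vb: "v \<le> 11/10 * e" "9/10 * e \<le> v" using u v e2 e by linarith+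
  have px: "\<bar>p + x'\<bar> \<le> m + 3" and qz: "\<bar>q + z'\<bar> \<le> m + 3" using pm small unfolding m_def by linarith+
  have b1: "\<bar>u * x'\<bar> \<le> (11/10 * e) * (2 * e * (m + 3))" "\<bar>v * z'\<bar> \<le> (11/10 * e) * (2 * e * (m + 3))"
    unfolding abs_mult using ub vb u v x' z' by (intro mult_mono; simp add: m_def)+
  have b2: "\<bar>u * v * (p + x')\<bar> \<le> ((11/10 * e) * (11/10 * e)) * (m + 3)"
    "\<bar>u * v * (q + z')\<bar> \<le> ((11/10 * e) * (11/10 * e)) * (m + 3)"
    unfolding abs_mult using ub vb u v px qz e by (intro mult_mono; simp)+
  have b3: "\<bar>(v - u) * q\<bar> \<le> 4 * e^2 * m"
    unfolding abs_mult m_def using u v by (intro mult_right_mono) auto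
  have "\<bar>u * (p + q)\<bar> = u" using pq u by (simp add: abs_mult)
  moreover have "x * (1 - v) + z * (1 - u) = u * (p + q) + (v - u) * q + u * x' + v * z'
     - u * v * (p + x') - u * v * (q + z')"
    unfolding x z by algebra
  ultimately have lower: "\<bar>x * (1 - v) + z * (1 - u)\<bar> \<ge> u - 4 * e^2 * m
     - 2 * ((11/10 * e) * (2 * e * (m + 3))) - 2 * (((11/10 * e) * (11/10 * e)) * (m + 3))"
    using b1 b2 b3 by linarith
  have xz: "x * z \<le> e^2 * (13/10 * m + 1/10 - 81/100 * m^2)"
  proof -
    have "p * q \<le> m - m^2"
    proof -
      have "p * q = (p + q) * q - q^2" by (simp add: power2_eq_square algebra_simps)
      moreover have "(p + q) * q \<le> 1 * m" unfolding m_def using pq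
        by (metis abs_le_D1 abs_mult order_refl mult_1)
      ultimately show ?thesis by (simp add: m_def)
    qed
    moreover have "\<bar>p * z'\<bar> \<le> (m + 1) * (3/1000)" "\<bar>x' * q\<bar> \<le> 3/1000 * m" "\<bar>x' * z'\<bar> \<le> 3/1000 * (3/1000)"
      unfolding abs_mult m_def[symmetric] using pm small m0 by (intro mult_mono; simp)+
    ultimately have pr: "(p + x') * (q + z') \<le> 1007/1000 * m + 5/1000 - m^2"
      unfolding distrib_left distrib_right by linarith
    have uvb: "u * v \<le> 121/100 * e^2" "81/100 * e^2 \<le> u * v"
    proof -
      have "u * v \<le> (11/10 * e) * (11/10 * e)" "(9/10 * e) * (9/10 * e) \<le> u * v"
        using ub vb u v e by (intro mult_mono; simp)+
      thus "u * v \<le> 121/100 * e^2" "81/100 * e^2 \<le> u * v" by (simp_all add: power2_eq_square)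
    qed
    have "x * z = (u * v) * ((p + x') * (q + z'))" unfolding x z by algebra
    also have "\<dots> \<le> (u * v) * (1007/1000 * m + 5/1000 - m^2)"
      using pr u v by (intro mult_left_mono) auto
    also have "\<dots> = (u * v) * (1007/1000 * m + 5/1000) - (u * v) * m^2" by algebra
    also have "\<dots> \<le> (121/100 * e^2) * (1007/1000 * m + 5/1000) - (81/100 * e^2) * m^2"
      using uvb m0 by (intro diff_mono mult_right_mono) auto
    also have "\<dots> = e^2 * ((121/100) * (1007/1000 * m + 5/1000) - 81/100 * m^2)" by algebra
    also have "\<dots> \<le> e^2 * (13/10 * m + 1/10 - 81/100 * m^2)"
      using m0 by (intro mult_left_mono) auto
    finally show ?thesis .
  qed
  have "e - 2 * e^2 - 4 * e^2 * m
     - 2 * ((11/10 * e) * (2 * e * (m + 3))) - 2 * (((11/10 * e) * (11/10 * e)) * (m + 3))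
     \<le> e + 7 * e^2 + e^2 * (13/10 * m + 1/10 - 81/100 * m^2)"
    using lower L xz u by linarith
  moreover have "(11/10 * e) * (2 * e * (m + 3)) = 22/10 * (e^2 * m) + 66/10 * e^2"
    "((11/10 * e) * (11/10 * e)) * (m + 3) = 121/100 * (e^2 * m) + 363/100 * e^2"
    "e^2 * (13/10 * m + 1/10 - 81/100 * m^2) = 13/10 * (e^2 * m) + 1/10 * e^2 - e^2 * (81/100 * m^2)"
    "e^2 * (122/10 * m + 30) = 122/10 * (e^2 * m) + 30 * e^2"
    by (simp_all add: algebra_simps power2_eq_square)
  moreover have "0 \<le> e^2 * m" using m0 by simp
  ultimately have "e^2 * (81/100 * m^2) \<le> e^2 * (122/10 * m + 30)"
    using e2 by linarith
  hence *: "81/100 * m^2 \<le> 122/10 * m + 30" using e by simp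
  show ?thesis
  proof (rule ccontr)
    assume "\<not> \<bar>q\<bar> < 18"
    hence m18: "18 \<le> m" by (simp add: m_def)
    hence "18 * m \<le> m^2" unfolding power2_eq_square by (intro mult_right_mono) auto
    thus False using * m18 by linarith
  qed
qed

section \<open>Negative continued fractions with large digits\<close>

text \<open>With the convergents' denominators q_0 = 0, q_1 = 1, q_(k+2) = a_k q_(k+1) - q_k, the ratio
  below is q_k / q_(k+1) and \<open>qden a k\<close> is q_(k+1). The difference q_(k+1) alpha - p_(k+1)
  is \<open>rem_prod \<alpha> (k+1)\<close>.\<close>

primrec qratio :: "(nat \<Rightarrow> int) \<Rightarrow> nat \<Rightarrow> real" where
  "qratio a 0 = 0"
| "qratio a (Suc k) = 1 / (of_int (a k) - qratio a k)"

primrec qden :: "(nat \<Rightarrow> int) \<Rightarrow> nat \<Rightarrow> real" where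
  "qden a 0 = 1"
| "qden a (Suc k) = qden a k / qratio a (Suc k)"

primrec rem_prod :: "real \<Rightarrow> nat \<Rightarrow> real" where
  "rem_prod \<alpha> 0 = 1"
| "rem_prod \<alpha> (Suc k) = ncf_rem \<alpha> k * rem_prod \<alpha> k"

text \<open>Twice the horizontal coordinate of the centre of the k-th divided cell, divided by q_(k+1).\<close>

primrec centre :: "(nat \<Rightarrow> int) \<Rightarrow> (nat \<Rightarrow> int) \<Rightarrow> nat \<Rightarrow> real" where
  "centre a s 0 = 1"
| "centre a s (Suc k) = qratio a (Suc k) * (of_int (s k) + centre a s k)"

text \<open>Serves both recursions: t is v_k with w = v_(k+1), or u_(k+1) with w = u_k. The last
  claim takes w = O(e) from the second claim for the neighbour.\<close>

lemma recip_expand: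
  fixes e d w t :: real
  assumes e: "0 < e" "e \<le> 1/1000000" and d: "0 \<le> d" "d \<le> 1" and w: "0 \<le> w" "w \<le> 1"
    and t: "t * (1/e + d - w) = 1"
  shows "0 < t" "t \<le> 2 * e" "\<bar>t - e\<bar> \<le> 2 * e^2"
    "w \<le> 2 * e \<Longrightarrow> \<bar>t - (e - d * e^2)\<bar> \<le> 5 * e^3"
proof -
  have big: "1/e \<ge> 1000000" using e by (simp add: field_simps)
  hence pos: "1/e + d - w > 0" using d w by linarith
  show t0: "0 < t" using t pos by (metis zero_less_mult_pos2 zero_less_one)
  have eq: "t - e = - (t * e * (d - w))"
  proof -
    have "e * (t * (1/e + d - w)) = e" using t by simp
    hence "t + e * t * d - e * t * w = e" using e by (simp add: algebra_simps)
    thus ?thesis by (simp add: algebra_simps)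
  qed
  have te: "t * e * \<bar>d - w\<bar> \<le> t * e * 1"
    using t0 e d w by (intro mult_left_mono) auto
  have dist: "\<bar>t - e\<bar> \<le> t * e"
    using te eq t0 e by (simp add: abs_mult)
  have "t * e \<le> t * (1/2)" using t0 e by (intro mult_left_mono) auto
  thus t2: "t \<le> 2 * e" using dist by linarith
  have "t * e \<le> 2 * e * e" using t2 e by (intro mult_right_mono) auto
  thus d2: "\<bar>t - e\<bar> \<le> 2 * e^2" using dist by (simp add: power2_eq_square)
  show "\<bar>t - (e - d * e^2)\<bar> \<le> 5 * e^3" if w2: "w \<le> 2 * e"
  proof -
    have "t - (e - d * e^2) = d * e * (e - t) + t * e * w"
      using eq by (simp add: algebra_simps power2_eq_square)
    also have "\<bar>\<dots>\<bar> \<le> \<bar>d * e * (e - t)\<bar> + \<bar>t * e * w\<bar>" by (rule abs_triangle_ineq)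
    also have "\<bar>d * e * (e - t)\<bar> \<le> 1 * e * (t * e)"
      unfolding abs_mult using d e dist t0 by (intro mult_mono) (auto simp: abs_minus_commute)
    also have "1 * e * (t * e) \<le> 1 * e * (1001/1000 * e * e)"
    proof -
      have "t * e \<le> t * (1/1000000)" using t0 e by (intro mult_left_mono) auto
      hence "t \<le> 1001/1000 * e" using dist by linarith
      thus ?thesis using e by (intro mult_left_mono mult_right_mono) auto
    qed
    also have "\<bar>t * e * w\<bar> \<le> (1001/1000 * e) * e * (2 * e)"
    proof -
      have "t * e \<le> t * (1/1000000)" using t0 e by (intro mult_left_mono) auto
      hence "t \<le> 1001/1000 * e" using dist by linarith
      thus ?thesis unfolding abs_mult using t0 e w w2 by (intro mult_mono) auto
    qed
    also have "1 * e * (1001/1000 * e * e) + (1001/1000 * e) * e * (2 * e) \<le> 5 * e^3"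
      using e by (simp add: power3_eq_cube)
    finally show ?thesis by simp
  qed
qed

locale ncf =
  fixes R :: int and \<alpha> :: real
  assumes odd_R: "odd R" and R_large: "R \<ge> 1000000"
    and alpha01: "0 < \<alpha>" "\<alpha> < 1"
    and digits: "\<And>n. ncf_digit \<alpha> n = period_block R ! (n mod 11)"
begin

abbreviation a :: "nat \<Rightarrow> int" where "a \<equiv> ncf_digit \<alpha>"
abbreviation v :: "nat \<Rightarrow> real" where "v \<equiv> ncf_rem \<alpha>"
abbreviation u :: "nat \<Rightarrow> real" where "u \<equiv> qratio a"
abbreviation Q :: "nat \<Rightarrow> real" where "Q \<equiv> qden a"
abbreviation D :: "nat \<Rightarrow> real" where "D \<equiv> rem_prod \<alpha>"
definition e :: real where "e = 1 / of_int R"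
definition d :: "nat \<Rightarrow> int" where "d k = a k - R"

lemma e_pos: "0 < e" and e_small: "e \<le> 1/1000000" and R_eq: "real_of_int R = 1/e"
proof -
  have R: "real_of_int R \<ge> 1000000" using R_large by linarith
  thus "0 < e" unfolding e_def by simp
  show "e \<le> 1/1000000" unfolding e_def using R by (simp add: field_simps)
  show "real_of_int R = 1/e" unfolding e_def by simp
qed

lemma mod_11_cases:
  "k mod 11 = 0 \<or> k mod 11 = 1 \<or> k mod 11 = 2 \<or> k mod 11 = 3 \<or> k mod 11 = 4
    \<or> k mod 11 = 5 \<or> k mod 11 = 6 \<or> k mod 11 = 7 \<or> k mod 11 = 8 \<or> k mod 11 = 9
    \<or> k mod 11 = 10" for k :: nat
  by arith

lemma d_mod: "d k = [0,0,1,0,1,1,0,1,1,0,1] ! (k mod 11)"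
  using mod_11_cases[of k] by (elim disjE) (simp_all add: d_def digits period_block_def)

lemma d_cases: "d k = 0 \<or> d k = 1"
  using mod_11_cases[of k] by (elim disjE) (simp_all add: d_mod)

lemma a_eq: "a k = R + d k"
  by (simp add: d_def)

lemma real_a: "real_of_int (a k) = 1/e + of_int (d k)"
  using R_eq by (simp add: a_eq)

lemma even_a: "even (a k) \<longleftrightarrow> d k = 1"
  using odd_R d_cases[of k] by (auto simp: a_eq)

lemma v_range: "0 < v k \<and> v k < 1"
proof (induction k)
  case 0
  show ?case using alpha01 by simp
next
  case (Suc k)
  have "ncf_rem \<alpha> (Suc k) \<noteq> 0"
  proof
    assume "ncf_rem \<alpha> (Suc k) = 0"
    \<comment> \<open>Division by zero gives 0, so a vanishing remainder would produce the digit
      0.\<close>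
    hence "a (Suc k) = 0" by (simp add: ncf_digit_def del: ncf_rem.simps)
    thus False using R_large d_cases[of "Suc k"] by (simp add: a_eq)
  qed
  moreover have "0 \<le> ncf_rem \<alpha> (Suc k)" by simp
  moreover have "ncf_rem \<alpha> (Suc k) < 1" by simp linarith
  ultimately show ?case by linarith
qed

lemma v_Suc: "v (Suc k) = of_int (a k) - 1 / v k"
  by (simp add: ncf_digit_def)

lemma v_rec: "v k * (of_int (a k) - v (Suc k)) = 1"
  using v_range[of k] by (simp add: v_Suc del: ncf_rem.simps)

lemma v_rec': "v k * (1/e + of_int (d k) - v (Suc k)) = 1"
  using v_rec[of k] unfolding real_a .

declare ncf_rem.simps(2) [simp del] qratio.simps(2) [simp del]

lemma d_range: "0 \<le> real_of_int (d k)" "real_of_int (d k) \<le> 1"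
  using d_cases[of k] by auto

lemma v_bounds: "0 < v k" "v k \<le> 2 * e" "\<bar>v k - e\<bar> \<le> 2 * e^2"
  using recip_expand[OF e_pos e_small d_range, of "v (Suc k)" "v k" k] v_rec'[of k] v_range[of "Suc k"]
  by auto

lemma v_expand: "\<bar>v k - (e - of_int (d k) * e^2)\<bar> \<le> 5 * e^3"
  using recip_expand(4)[OF e_pos e_small d_range, of "v (Suc k)" "v k" k] v_rec'[of k]
    v_range[of "Suc k"] v_bounds(2)[of "Suc k"] by auto

lemma u_range: "0 \<le> u k \<and> u k < 1"
proof (induction k)
  case (Suc k)
  have "real_of_int (a k) \<ge> 1000000" using R_large d_cases[of k] a_eq[of k] by auto
  hence "real_of_int (a k) - u k > 1" using Suc by linarith
  thus ?case unfolding qratio.simps(2) by simp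
qed simp

lemma u_rec: "u (Suc k) * (of_int (a k) - u k) = 1"
proof -
  have "real_of_int (a k) \<ge> 1000000" using R_large d_cases[of k] a_eq[of k] by auto
  hence "real_of_int (a k) - u k > 0" using u_range[of k] by linarith
  thus ?thesis unfolding qratio.simps(2) by simp
qed

lemma u_rec': "u (Suc k) * (1/e + of_int (d k) - u k) = 1"
  using u_rec[of k] unfolding real_a .

lemma u_Suc_bounds: "0 < u (Suc k)" "u (Suc k) \<le> 2 * e" "\<bar>u (Suc k) - e\<bar> \<le> 2 * e^2"
  using recip_expand[OF e_pos e_small d_range, of "u k" "u (Suc k)" k] u_rec'[of k] u_range[of k]
  by auto

lemma u_expand: "\<bar>u (Suc k) - (e - of_int (d k) * e^2)\<bar> \<le> 5 * e^3"
proof -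
  have "u k \<le> 2 * e" using u_Suc_bounds(2) e_pos by (cases k) auto
  thus ?thesis
    using recip_expand(4)[OF e_pos e_small d_range, of "u k" "u (Suc k)" k] u_rec'[of k]
      u_range[of k] by auto
qed

lemma Q_pos: "0 < Q k"
  by (induction k) (use u_Suc_bounds(1) in auto)

lemma D_pos: "0 < D k"
  by (induction k) (use v_bounds(1) in auto)

lemma Q_Suc: "u (Suc k) * Q (Suc k) = Q k"
  using u_Suc_bounds(1)[of k] by simp

lemma Q_ge: "Q k \<ge> 2 ^ k"
proof (induction k)
  case (Suc k)
  have "u (Suc k) \<le> 1/2" using u_Suc_bounds(2)[of k] e_small by linarith
  from mult_right_mono[OF this less_imp_le[OF Q_pos[of "Suc k"]]]
  have "Q k \<le> 1/2 * Q (Suc k)" unfolding Q_Suc .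
  thus ?case using Suc by (simp del: qden.simps)
qed simp

lemma D_le: "D k \<le> (1/2) ^ k"
proof (induction k)
  case (Suc k)
  have "v k * D k \<le> 1/2 * (1/2) ^ k"
    using v_bounds(1)[of k] v_bounds(2)[of k] e_small Suc D_pos[of k] by (intro mult_mono) auto
  thus ?case by simp
qed simp

text \<open>The left side is the determinant q_(k+1) D_k - q_k D_(k+1) of two consecutive
  convergents, because u_k Q_k = q_k and v_k D_k = D_(k+1).\<close>

lemma area: "Q k * D k * (1 - u k * v k) = 1"
proof (induction k)
  case (Suc k)
  have 1: "v k * of_int (a k) = 1 + v k * v (Suc k)" using v_rec[of k] by (simp add: algebra_simps)
  have 2: "u (Suc k) * of_int (a k) = 1 + u (Suc k) * u k" using u_rec[of k] by (simp add: algebra_simps)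
  have 3: "v k * (1 - u (Suc k) * v (Suc k)) = u (Suc k) * (1 - u k * v k)"
    using 1 2 by algebra
  have "u (Suc k) * (Q (Suc k) * D (Suc k) * (1 - u (Suc k) * v (Suc k)))
     = (u (Suc k) * Q (Suc k)) * D k * (v k * (1 - u (Suc k) * v (Suc k)))"
    unfolding rem_prod.simps by (simp only: mult_ac)
  also have "\<dots> = u (Suc k) * (Q k * D k * (1 - u k * v k))"
    unfolding Q_Suc 3 by (simp only: mult_ac)
  finally show ?case using Suc u_Suc_bounds(1)[of k] by simp
qed simp

end

text \<open>The centre of level k is (Q_k x_k / 2, -D_k z_k / 2); passing to level k + 1 moves it by
  s_k / 2 times (q_(k+1), D_(k+1)). The x_k are built from earlier s, whereas the recursion for z
  looks forward, so z is a parameter. The integer j translates gamma so that z_0 can be made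
  small.\<close>

locale cell = ncf +
  fixes \<gamma> :: real and s :: "nat \<Rightarrow> int" and z :: "nat \<Rightarrow> real" and j :: int
  assumes parity: "\<And>k. even (s k - ncf_digit \<alpha> k)"
    and z_rec: "\<And>k. z k = ncf_rem \<alpha> k * (of_int (s k) + z (Suc k))"
    and z_0: "z 0 = 1 - \<alpha> + 2 * \<gamma> - 2 * of_int j"
begin

abbreviation x :: "nat \<Rightarrow> real" where "x \<equiv> centre a s"

lemma x_Suc: "x (Suc k) = u (Suc k) * (of_int (s k) + x k)"
  by simp

declare centre.simps(2) [simp del]

text \<open>Change of basis by q_k = a_k q_(k+1) - q_(k+2), combined with the displacement of the
  centre by s_k. The parity condition on s_k is what keeps N' odd.\<close>

lemma grid_step:
  fixes M N :: int and k :: nat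
  defines "M' \<equiv> - N" and "N' \<equiv> M + a k * N - s k"
  shows "Q (Suc k) * (x (Suc k) + of_int M' + of_int N' * u (Suc k)) = Q k * (x k + of_int M + of_int N * u k)"
    and "D (Suc k) * (- z (Suc k) + of_int M' * v (Suc k) + of_int N')
       = D k * (- z k + of_int M * v k + of_int N)"
proof -
  have 2: "u (Suc k) * of_int (a k) = 1 + u (Suc k) * u k" using u_rec[of k] by (simp add: algebra_simps)
  have "x (Suc k) + of_int M' + of_int N' * u (Suc k) = u (Suc k) * (x k + of_int M + of_int N * u k)"
    unfolding x_Suc M'_def N'_def of_int_add of_int_diff of_int_mult of_int_minus using 2 by algebra
  thus "Q (Suc k) * (x (Suc k) + of_int M' + of_int N' * u (Suc k)) = Q k * (x k + of_int M + of_int N * u k)"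
    unfolding Q_Suc[of k, symmetric] by (simp only: mult_ac)
  have 1: "v k * of_int (a k) = 1 + v k * v (Suc k)" using v_rec[of k] by (simp add: algebra_simps)
  have "v k * (- z (Suc k) + of_int M' * v (Suc k) + of_int N') = - z k + of_int M * v k + of_int N"
    unfolding z_rec[of k] M'_def N'_def of_int_add of_int_diff of_int_mult of_int_minus using 1 by algebra
  thus "D (Suc k) * (- z (Suc k) + of_int M' * v (Suc k) + of_int N')
       = D k * (- z k + of_int M * v k + of_int N)"
    unfolding rem_prod.simps by (metis mult.assoc mult.commute)
qed

lemma grid_coords:
  fixes n m :: int
  shows "\<exists>M N. odd M \<and> odd N \<and> 2 * of_int n = Q k * (x k + of_int M + of_int N * u k)
    \<and> 2 * (of_int n * \<alpha> - of_int m - \<gamma>) = D k * (- z k + of_int M * v k + of_int N)"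
proof (induction k)
  case 0
  \<comment> \<open>At level 0 the basis is (1, alpha), (0, 1), because \<open>u 0 = 0\<close>; with
    \<open>x 0 = 1\<close> the equation 2 n = 1 + M gives M.\<close>
  show ?case
    by (rule exI[of _ "2 * n - 1"], rule exI[of _ "1 - 2 * j - 2 * m"])
       (simp add: z_0 algebra_simps)
next
  case (Suc k)
  then obtain M N where MN: "odd M" "odd N"
    "2 * of_int n = Q k * (x k + of_int M + of_int N * u k)"
    "2 * (of_int n * \<alpha> - of_int m - \<gamma>) = D k * (- z k + of_int M * v k + of_int N)" by blast
  have "odd (M + a k * N - s k)"
    using MN(1,2) parity[of k] by auto
  moreover have "odd (- N)" using MN by simp
  ultimately show ?case using MN(3,4) grid_step[of k N M] by metis
qed

text \<open>Converse of \<open>grid_coords\<close>, by inverting the unimodular step. It guarantees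
  that the vertices of every cell are genuine grid points, as the upper bound requires.\<close>

lemma grid_point:
  fixes M N :: int
  assumes "odd M" "odd N"
  shows "\<exists>n m :: int. 2 * of_int n = Q k * (x k + of_int M + of_int N * u k)
    \<and> 2 * (of_int n * \<alpha> - of_int m - \<gamma>) = D k * (- z k + of_int M * v k + of_int N)"
  using assms
proof (induction k arbitrary: M N)
  case 0
  obtain n where n: "M = 2 * n + 1" using 0 by (auto elim: oddE)
  obtain m where m: "N = 2 * m + 1" using 0 by (auto elim: oddE)
  show ?case
    by (rule exI[of _ "n + 1"], rule exI[of _ "- m - j"])
       (simp add: z_0 n m algebra_simps)
next
  case (Suc k)
  define N0 where "N0 = - M"
  define M0 where "M0 = N + a k * M + s k"
  have "odd N0" using Suc.prems by (simp add: N0_def)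
  moreover have "odd M0"
    using Suc.prems parity[of k] by (auto simp: M0_def)
  moreover have "M = - N0" "N = M0 + a k * N0 - s k" by (simp_all add: N0_def M0_def)
  ultimately show ?case using Suc.IH[of M0 N0] grid_step[of k N0 M0] by metis
qed

lemma grid_product:
  assumes "2 * X = Q k * A" and "2 * Y = D k * B"
  shows "4 * \<bar>X * Y\<bar> * (1 - u k * v k) = \<bar>A\<bar> * \<bar>B\<bar>"
proof -
  have pos: "1 - u k * v k > 0"
    using area[of k] Q_pos[of k] D_pos[of k] by (metis zero_less_mult_pos zero_less_one mult_pos_pos)
  have "4 * (X * Y) * (1 - u k * v k) = (2 * X) * (2 * Y) * (1 - u k * v k)" by simp
  also have "\<dots> = (Q k * D k * (1 - u k * v k)) * (A * B)"
    unfolding assms by (simp only: mult_ac)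
  finally have "4 * (X * Y) * (1 - u k * v k) = A * B" unfolding area by simp
  hence "\<bar>4 * (X * Y) * (1 - u k * v k)\<bar> = \<bar>A * B\<bar>" by simp
  thus ?thesis using pos by (simp add: abs_mult)
qed

end

section \<open>The lower bound\<close>

text \<open>First order expansion of x or z. The bound 42 e is 2 e (20 + 1), from a shift at most 20
  and a neighbour at most 1.\<close>

lemma recip_mult_bound:
  fixes e t s w :: real
  assumes e: "0 < e" "e \<le> 1/1000000" and t: "0 < t" "\<bar>t - e\<bar> \<le> 2 * e^2"
    and s: "\<bar>s\<bar> \<le> 20" and w: "\<bar>w\<bar> \<le> 42 * e"
  shows "\<bar>t * (s + w) - e * s\<bar> \<le> 90 * e^2"
proof -
  have "e^2 \<le> e * (1/1000000)" using e unfolding power2_eq_square by (intro mult_left_mono) auto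
  hence te: "t \<le> 11/10 * e" using t e by linarith
  have "\<bar>(t - e) * s\<bar> \<le> (2 * e^2) * 20" unfolding abs_mult using t s by (intro mult_mono) auto
  moreover have "\<bar>t * w\<bar> \<le> (11/10 * e) * (42 * e)"
    unfolding abs_mult using te t w by (intro mult_mono) auto
  moreover have "(11/10 * e) * (42 * e) = 462/10 * e^2" by (simp add: power2_eq_square)
  moreover have "t * (s + w) - e * s = (t - e) * s + t * w" by algebra
  ultimately show ?thesis using zero_le_power2[of e] by linarith
qed

text \<open>The lower bound on the first factor means that the previous denominator is less than |n|;
  it is what keeps the product large when |N| is of order R.\<close>

lemma nonvertex_bound:
  fixes e u v x z :: real and M N :: int
  assumes e: "0 < e" "e \<le> 1/1000000"
    and u: "\<bar>u - e\<bar> \<le> 2 * e^2" and v: "0 < v" "v \<le> 2 * e"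
    and x: "\<bar>x\<bar> \<le> 4 * e" and z: "\<bar>z\<bar> \<le> 4 * e"
    and odd: "odd M" "odd N"
    and A: "2 * u \<le> \<bar>x + of_int M + of_int N * u\<bar>" "\<bar>x + of_int M + of_int N * u\<bar> \<le> 2"
    and nv: "\<not> (\<bar>M\<bar> = 1 \<and> \<bar>N\<bar> = 1)"
  shows "1 \<le> \<bar>x + of_int M + of_int N * u\<bar> * \<bar>- z + of_int M * v + of_int N\<bar>"
proof -
  define m where "m = \<bar>real_of_int M\<bar>"
  define n where "n = \<bar>real_of_int N\<bar>"
  have e2: "e^2 \<le> e * (1/1000000)" using e unfolding power2_eq_square by (intro mult_left_mono) auto
  have ub: "u \<le> 1001/1000 * e" "999/1000 * e \<le> u" using u e2 e by linarith+
  have u0: "0 < u" using ub e by linarith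
  have Nu: "\<bar>real_of_int N * u\<bar> = n * u" and Mv: "\<bar>real_of_int M * v\<bar> = m * v"
    using u0 v by (simp_all add: m_def n_def abs_mult)
  have m1: "1 \<le> m" and n1: "1 \<le> n"
    using odd unfolding m_def n_def by (cases "M = 0"; cases "N = 0"; simp; linarith)+
  have n0: "0 \<le> n" "0 \<le> m" using m1 n1 by auto
  have mle: "m \<le> 2 + 4 * e + n * u" using A(2) x Nu unfolding m_def by linarith
  show ?thesis
  \<comment> \<open>If n e <= 6/10, then |M| = 1 and |N| >= 3, and the factors are about 0.4 and 3
    at least. Otherwise the second factor is nearly |N| > 0.6 R, and 2 u |N| exceeds 1 with room to
    spare.\<close>
  proof (cases "n * e \<le> 6/10")
    case True
    have "n * u \<le> n * (1001/1000 * e)" using ub n0 by (intro mult_left_mono) auto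
    hence nu: "n * u \<le> 601/1000" using True by linarith
    have "m < 3" using mle nu e by linarith
    hence "\<bar>M\<bar> < 3" unfolding m_def by linarith
    hence M1: "\<bar>M\<bar> = 1" using odd(1) by (auto simp: abs_if split: if_splits) presburger+
    hence "\<bar>N\<bar> \<noteq> 1" using nv by simp
    hence "\<bar>N\<bar> \<ge> 3" using odd(2) by (auto simp: abs_if split: if_splits) presburger+
    hence n3: "3 \<le> n" unfolding n_def by linarith
    have m_eq: "m = 1" using M1 unfolding m_def by linarith
    have f1: "399/1000 - 4 * e \<le> \<bar>x + of_int M + of_int N * u\<bar>"
      using x Nu nu m_eq unfolding m_def by linarith
    have "\<bar>real_of_int M * v\<bar> = v" using Mv m_eq by simp
    hence f2: "3 - 6 * e \<le> \<bar>- z + of_int M * v + of_int N\<bar>"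
      using z v n3 unfolding n_def by linarith
    have "(39/100) * (29/10) \<le> \<bar>x + of_int M + of_int N * u\<bar> * \<bar>- z + of_int M * v + of_int N\<bar>"
      using f1 f2 e by (intro mult_mono) auto
    thus ?thesis by simp
  next
    case False
    have "m * v \<le> (2 + 4 * e + n * u) * v" using mle v by (intro mult_right_mono) auto
    also have "\<dots> \<le> (2 + 4 * e + n * u) * (2 * e)" using v u0 n0 e by (intro mult_left_mono) auto
    also have "\<dots> = 4 * e + 8 * (e * e) + 2 * (n * u) * e" by (simp add: algebra_simps)
    finally have mv: "m * v \<le> 4 * e + 8 * (e * e) + 2 * (n * u) * e" .
    have "u \<le> 1" using ub e by linarith
    hence "n * u \<le> n * 1" using n0 by (intro mult_left_mono) auto
    hence "(n * u) * e \<le> n * (1/1000000)" using e u0 n0 by (intro mult_mono) auto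
    moreover have "e * e \<le> 1 * (1/1000000)" using e by (intro mult_mono) auto
    ultimately have f2: "98/100 * n \<le> \<bar>- z + of_int M * v + of_int N\<bar>"
      using mv Mv z e n1 unfolding n_def m_def by linarith
    have "1 \<le> (2 * (999/1000 * e)) * (98/100 * n)" using False by (simp add: algebra_simps)
    also have "\<dots> \<le> \<bar>x + of_int M + of_int N * u\<bar> * \<bar>- z + of_int M * v + of_int N\<bar>"
      using f2 A(1) ub e n0 by (intro mult_mono) auto
    finally show ?thesis .
  qed
qed

section \<open>Second order expansion at the opposite vertices\<close>

context cell begin

text \<open>To second order x_(k+2) depends on s_(k+1), s_k and z_(k+2) on s_(k+2), s_(k+3). The
  digits entering u_(k+2) and v_(k+2) at that order are a_(k+1) and a_(k+2).\<close>

lemma vertex_expand: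
  fixes c :: int
  assumes s: "\<bar>s k\<bar> \<le> 20" "\<bar>s (k+1)\<bar> \<le> 20" "\<bar>s (k+2)\<bar> \<le> 20" "\<bar>s (k+3)\<bar> \<le> 20"
    and x: "\<bar>x k\<bar> \<le> 42 * e" and z: "\<bar>z (k+4)\<bar> \<le> 42 * e" and c: "c = 1 \<or> c = -1"
  shows "\<bar>(1 - u (k+2) - of_int c * x (k+2)) * (1 - v (k+2) - of_int c * z (k+2))
     - (1 - 3 * e + 4 * e^2) * (1 - u (k+2) * v (k+2))
    - (e * of_int (1 - c * (s (k+1) + s (k+2))) + e^2 * of_int (d (k+1) + d (k+2) - 2 + s (k+1) * s (k+2)
      + c * (s (k+1) + s (k+2)) - c * (s k + s (k+3) - d (k+1) * s (k+1) - d (k+2) * s (k+2))))\<bar>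
    \<le> 130000 * e^3"
proof -
  have x1: "\<bar>x (k+1) - e * of_int (s k)\<bar> \<le> 90 * e^2"
    using recip_mult_bound[OF e_pos e_small u_Suc_bounds(1,3), of "of_int (s k)" "x k" k] s x
    by (simp add: x_Suc)
  have z1: "\<bar>z (k+3) - e * of_int (s (k+3))\<bar> \<le> 90 * e^2"
    using recip_mult_bound[OF e_pos e_small v_bounds(1,3), of "of_int (s (k+3))" "z (k+4)" "k+3"] s z
      z_rec[of "k+3"] by (simp add: eval_nat_numeral)
  have xe: "x (k+2) = u (k+2) * (of_int (s (k+1)) + x (k+1))" using x_Suc[of "k+1"] by simp
  have ze: "z (k+2) = v (k+2) * (of_int (s (k+2)) + z (k+3))"
    using z_rec[of "k+2"] by (simp add: eval_nat_numeral)
  have ue: "\<bar>u (k+2) - (e - of_int (d (k+1)) * e^2)\<bar> \<le> 5 * e^3" using u_expand[of "k+1"] by simp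
  have sr: "\<bar>real_of_int (s k)\<bar> \<le> 20" "\<bar>real_of_int (s (k+1))\<bar> \<le> 20"
    "\<bar>real_of_int (s (k+2))\<bar> \<le> 20" "\<bar>real_of_int (s (k+3))\<bar> \<le> 20" using s by linarith+
  have "approx2 e 220 (x (k+2)) 0 (of_int (s (k+1))) (of_int (s k) - of_int (d (k+1)) * of_int (s (k+1)))"
    unfolding xe by (rule approx2_centre[OF e_pos e_small ue d_range sr(2) sr(1) x1])
  moreover have "approx2 e 220 (z (k+2)) 0 (of_int (s (k+2))) (of_int (s (k+3)) - of_int (d (k+2)) * of_int (s (k+2)))"
    unfolding ze by (rule approx2_centre[OF e_pos e_small v_expand d_range sr(3) sr(4) z1])
  ultimately show ?thesis
    using cell_expand[OF e_pos e_small ue v_expand[of "k+2"] d_range[of "k+1"] d_range[of "k+2"]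
        sr(2) sr(3) sr(1) sr(4), of "x (k+2)" "z (k+2)" "of_int c"] c
    by auto
qed

lemma uv_range: "0 \<le> u k * v k" "u k * v k \<le> 1/2"
proof -
  show "0 \<le> u k * v k" using u_range[of k] v_range[of k] by simp
  have "u k * v k \<le> 1 * (1/2)"
    using u_range[of k] v_bounds(1,2)[of k] e_small by (intro mult_mono) auto
  thus "u k * v k \<le> 1/2" by simp
qed

end

text \<open>The assumption \<open>second\<close> says that the coefficient of e^2 is at least 4 at
  the vertex where the order e term matches the target; the opposite choices of c leave slack of
  order e.\<close>

locale bounded_cell = cell +
  assumes s_le: "\<bar>s k\<bar> \<le> 1" and z_le: "\<bar>z k\<bar> \<le> 1"
    and adj: "\<bar>s k + s (Suc k)\<bar> \<le> 1"
    and second: "c = 1 \<or> c = -1 \<Longrightarrow> c * (s (k+1) + s (k+2)) = 1 \<Longrightarrow>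
      0 \<le> d (k+1) + d (k+2) + s (k+1) * s (k+2) - 1
        - c * (s k + s (k+3) - d (k+1) * s (k+1) - d (k+2) * s (k+2))"
begin

lemma z_small: "\<bar>z k\<bar> \<le> 4 * e"
proof -
  have "\<bar>real_of_int (s k)\<bar> \<le> 1" using s_le[of k] by linarith
  hence "\<bar>of_int (s k) + z (Suc k)\<bar> \<le> 2" using z_le[of "Suc k"] by linarith
  hence "\<bar>v k * (of_int (s k) + z (Suc k))\<bar> \<le> (2 * e) * 2"
    unfolding abs_mult using v_bounds[of k] by (intro mult_mono) auto
  thus ?thesis using z_rec[of k] by simp
qed

lemma x_small: "\<bar>x (Suc k)\<bar> \<le> 4 * e"
proof (induction k)
  case 0
  have "\<bar>real_of_int (s 0)\<bar> \<le> 1" using s_le[of 0] by linarith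
  hence "\<bar>of_int (s 0) + x 0\<bar> \<le> 2" by simp
  hence "\<bar>u (Suc 0) * (of_int (s 0) + x 0)\<bar> \<le> (2 * e) * 2"
    unfolding abs_mult using u_Suc_bounds[of 0] by (intro mult_mono) auto
  thus ?case unfolding x_Suc by simp
next
  case (Suc k)
  have "\<bar>real_of_int (s (Suc k))\<bar> \<le> 1" using s_le[of "Suc k"] by linarith
  hence "\<bar>of_int (s (Suc k)) + x (Suc k)\<bar> \<le> 2" using Suc e_small by linarith
  hence "\<bar>u (Suc (Suc k)) * (of_int (s (Suc k)) + x (Suc k))\<bar> \<le> (2 * e) * 2"
    unfolding abs_mult using u_Suc_bounds[of "Suc k"] by (intro mult_mono) auto
  thus ?case unfolding x_Suc[of "Suc k"] by simp
qed

definition r :: real where "r = 1 - 3 * e + 4 * e^2 - 300000 * e^3"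

lemma e_powers: "0 < e^2" "e^2 \<le> e * (1/1000000)" "0 < e^3" "e^3 \<le> e^2 * (1/1000000)"
  using e_pos e_small by (auto simp: power2_eq_square power3_eq_cube intro!: mult_left_mono)

text \<open>Any product known to be at least 1 - 2 e thus needs no second order analysis.\<close>

lemma r_mult_le: "r * (1 - u k * v k) \<le> 1 - 2 * e"
proof (cases "r \<ge> 0")
  case True
  from mult_left_mono[OF _ this, of "1 - u k * v k" 1] have "r * (1 - u k * v k) \<le> r"
    using uv_range[of k] by simp
  moreover have "r \<le> 1 - 2 * e" unfolding r_def using e_powers e_pos by linarith
  ultimately show ?thesis by linarith
next
  case False
  hence "r * (1 - u k * v k) \<le> 0" using uv_range[of k] by (intro mult_nonpos_nonneg) auto
  thus ?thesis using e_small by linarith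
qed

text \<open>The expansion starts from \<open>x k\<close>, which is small only for k >= 1, as
  \<open>x 0 = 1\<close>.\<close>

lemma opposite_vertex:
  fixes c :: int
  assumes c: "c = 1 \<or> c = -1" and k: "k \<ge> 1"
  shows "r * (1 - u (k+2) * v (k+2))
    \<le> (1 - u (k+2) - of_int c * x (k+2)) * (1 - v (k+2) - of_int c * z (k+2))"
proof -
  have s20: "\<bar>s i\<bar> \<le> 20" for i using s_le[of i] by linarith
  have xk: "\<bar>x k\<bar> \<le> 42 * e" using x_small[of "k-1"] k e_pos by simp
  have zk: "\<bar>z (k+4)\<bar> \<le> 42 * e" using z_small[of "k+4"] e_pos by linarith
  define S where "S = c * (s (k+1) + s (k+2))"
  define T where "T = d (k+1) + d (k+2) - 2 + s (k+1) * s (k+2) + S - c * (s k + s (k+3) - d (k+1) * s (k+1) - d (k+2) * s (k+2))"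
  have main: "(1 - 3 * e + 4 * e^2) * (1 - u (k+2) * v (k+2)) + e * of_int (1 - S) + e^2 * of_int T - 130000 * e^3
    \<le> (1 - u (k+2) - of_int c * x (k+2)) * (1 - v (k+2) - of_int c * z (k+2))"
    using vertex_expand[OF s20 s20 s20 s20 xk zk c] unfolding S_def[symmetric] T_def[symmetric]
    by linarith
  have "\<bar>s (k+1) + s (k+2)\<bar> \<le> 1" using adj[of "k+1"] by simp
  hence S1: "\<bar>S\<bar> \<le> 1" using c by (auto simp: S_def)
  \<comment> \<open>For S = 1 the first order term vanishes and \<open>second\<close> decides;
    otherwise 1 - S >= 1, and a gain of e outweighs 10 e^2.\<close>
  have low: "0 \<le> e * of_int (1 - S) + e^2 * of_int T"
  proof (cases "S = 1")
    case True
    have "0 \<le> T" using second[OF c, of k] True unfolding S_def T_def by simp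
    thus ?thesis using True e_powers by simp
  next
    case False
    hence "1 \<le> 1 - S" using S1 by linarith
    hence S2: "1 \<le> real_of_int (1 - S)" by linarith
    have pr: "\<bar>s i * t\<bar> \<le> 1" if "\<bar>t\<bar> \<le> 1" for i t
      using mult_mono[of "\<bar>s i\<bar>" 1 "\<bar>t\<bar>" 1] s_le[of i] that by (simp add: abs_mult)
    have "\<bar>d i\<bar> \<le> 1" for i using d_cases[of i] by auto
    hence ds: "\<bar>s (k+1) * d (k+1)\<bar> \<le> 1" "\<bar>s (k+2) * d (k+2)\<bar> \<le> 1" "\<bar>s (k+1) * s (k+2)\<bar> \<le> 1"
      using pr s_le by auto
    have "- 10 \<le> T"
      using c ds S1 s_le[of k] s_le[of "k+3"] s_le[of "k+1"] s_le[of "k+2"] d_cases[of "k+1"] d_cases[of "k+2"]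
      unfolding T_def S_def by (auto simp: mult.commute)
    hence "- 10 \<le> real_of_int T" by linarith
    hence "e^2 * (- 10) \<le> e^2 * of_int T" using e_powers by (intro mult_left_mono) auto
    moreover have "e * 1 \<le> e * of_int (1 - S)" using S2 e_pos by (intro mult_left_mono) auto
    ultimately show ?thesis using e_powers e_pos by linarith
  qed
  have "r * (1 - u (k+2) * v (k+2)) = (1 - 3 * e + 4 * e^2) * (1 - u (k+2) * v (k+2))
     - 300000 * e^3 * (1 - u (k+2) * v (k+2))"
    unfolding r_def by algebra
  moreover have "300000 * e^3 * (1/2) \<le> 300000 * e^3 * (1 - u (k+2) * v (k+2))"
    using uv_range[of "k+2"] e_powers by (intro mult_left_mono) auto
  ultimately show ?thesis using main low e_powers by linarith
qed

text \<open>Vertices (1, 1) and (-1, -1): as |s| <= 1, |x| and |z| exceed u and v by O(e^2) at most,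
  so the added u and v compensate any loss in the two factors.\<close>

lemma same_vertex:
  fixes c :: real
  assumes c: "c = 1 \<or> c = -1"
  shows "r * (1 - u (k+2) * v (k+2))
    \<le> (1 + u (k+2) + c * x (k+2)) * (1 + v (k+2) - c * z (k+2))"
proof -
  have xe: "x (k+2) = u (k+2) * (of_int (s (k+1)) + x (k+1))" using x_Suc[of "k+1"] by simp
  have ze: "z (k+2) = v (k+2) * (of_int (s (k+2)) + z (k+3))"
    using z_rec[of "k+2"] by (simp add: eval_nat_numeral)
  have "\<bar>real_of_int (s (k+1))\<bar> \<le> 1" "\<bar>real_of_int (s (k+2))\<bar> \<le> 1"
    using s_le[of "k+1"] s_le[of "k+2"] by linarith+
  hence b: "\<bar>of_int (s (k+1)) + x (k+1)\<bar> \<le> 1 + 4 * e" "\<bar>of_int (s (k+2)) + z (k+3)\<bar> \<le> 1 + 4 * e"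
    using x_small[of k] z_small[of "k+3"] by simp_all
  have u: "0 < u (k+2)" "u (k+2) \<le> 2 * e" using u_Suc_bounds[of "k+1"] by simp_all
  have v: "0 < v (k+2)" "v (k+2) \<le> 2 * e" using v_bounds[of "k+2"] by simp_all
  have bx: "\<bar>x (k+2)\<bar> \<le> u (k+2) * (1 + 4 * e)" unfolding xe abs_mult
    using b u by (intro mult_mono) auto
  have bz: "\<bar>z (k+2)\<bar> \<le> v (k+2) * (1 + 4 * e)" unfolding ze abs_mult
    using b v by (intro mult_mono) auto
  have t: "u (k+2) * (4 * e) \<le> 2 * e * (4 * e)" "v (k+2) * (4 * e) \<le> 2 * e * (4 * e)"
    using u v e_pos by (intro mult_right_mono; simp)+
  have t2: "2 * e * (4 * e) = 8 * e^2" by (simp add: power2_eq_square)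
  have cx: "\<bar>c * x (k+2)\<bar> = \<bar>x (k+2)\<bar>" "\<bar>c * z (k+2)\<bar> = \<bar>z (k+2)\<bar>" using c by auto
  have f: "1 - e/2 \<le> 1 + u (k+2) + c * x (k+2)" "1 - e/2 \<le> 1 + v (k+2) - c * z (k+2)"
    using cx bx bz t t2 e_powers e_pos unfolding distrib_left[of "u (k+2)"] distrib_left[of "v (k+2)"]
    by linarith+
  have "1 - 2 * e \<le> (1 - e/2) * (1 - e/2)" using e_pos by (simp add: algebra_simps)
  also have "\<dots> \<le> (1 + u (k+2) + c * x (k+2)) * (1 + v (k+2) - c * z (k+2))"
    using f e_small by (intro mult_mono) auto
  finally show ?thesis using r_mult_le[of "k+2"] by linarith
qed

lemma level_bound:
  fixes M N :: int
  assumes k: "k \<ge> 1" and odd: "odd M" "odd N"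
    and A: "2 * u (k+2) \<le> \<bar>x (k+2) + of_int M + of_int N * u (k+2)\<bar>"
      "\<bar>x (k+2) + of_int M + of_int N * u (k+2)\<bar> \<le> 2"
  shows "r * (1 - u (k+2) * v (k+2))
    \<le> \<bar>x (k+2) + of_int M + of_int N * u (k+2)\<bar> * \<bar>- z (k+2) + of_int M * v (k+2) + of_int N\<bar>"
proof (cases "\<bar>M\<bar> = 1 \<and> \<bar>N\<bar> = 1")
  case True
  hence MN: "M = 1 \<or> M = -1" "N = 1 \<or> N = -1" by linarith+
  have ab: "p * q \<le> \<bar>p'\<bar> * \<bar>q'\<bar>" if "p = p' \<and> q = q' \<or> p = -p' \<and> q = -q' \<or> p = p' \<and> q = -q' \<or> p = -p' \<and> q = q'" for p q p' q' :: real
    using that by (auto simp: abs_mult[symmetric])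
  note o = opposite_vertex[OF _ k]
  from MN show ?thesis
  proof (elim disjE)
    assume [simp]: "M = 1" "N = 1"
    show ?thesis by (rule order_trans[OF same_vertex[of 1] ab]) (auto simp: algebra_simps)
  next
    assume [simp]: "M = 1" "N = -1"
    show ?thesis by (rule order_trans[OF o[of "-1"] ab]) (auto simp: algebra_simps)
  next
    assume [simp]: "M = -1" "N = 1"
    show ?thesis by (rule order_trans[OF o[of 1] ab]) (auto simp: algebra_simps)
  next
    assume [simp]: "M = -1" "N = -1"
    show ?thesis by (rule order_trans[OF same_vertex[of "-1"] ab]) (auto simp: algebra_simps)
  qed
next
  case False
  have "1 \<le> \<bar>x (k+2) + of_int M + of_int N * u (k+2)\<bar> * \<bar>- z (k+2) + of_int M * v (k+2) + of_int N\<bar>"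
    using u_Suc_bounds(3)[of "k+1"] x_small[of "k+1"]
    by (intro nonvertex_bound[OF e_pos e_small _ v_bounds(1,2) _ z_small odd A False]) simp_all
  thus ?thesis using r_mult_le[of "k+2"] e_pos by linarith
qed

lemma Mval_ge: "ereal (r / 4) \<le> Mval \<alpha> \<gamma>"
proof -
  have bound: "r / 4 \<le> \<bar>real_of_int n\<bar> * dnint (real_of_int n * \<alpha> - \<gamma>)" if n: "Q 2 < \<bar>of_int n\<bar>" for n :: int
  proof -
    obtain K0 where "\<bar>of_int n\<bar> < (2::real) ^ K0" using real_arch_pow[of 2] by auto
    hence ex: "\<exists>K. \<bar>of_int n\<bar> \<le> Q K" using Q_ge[of K0] by (intro exI[of _ K0]) linarith
    \<comment> \<open>The choice Q_(K-1) < |n| <= Q_K becomes 2 u_K < |A| <= 2 in cell coordinates.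
      Starting from |n| > Q_2 gives K >= 3, so x is already small two levels earlier.\<close>
    define K where "K = (LEAST K. \<bar>of_int n\<bar> \<le> Q K)"
    have K: "\<bar>of_int n\<bar> \<le> Q K" unfolding K_def by (rule LeastI_ex[OF ex])
    have Kl: "Q i < \<bar>of_int n\<bar>" if "i < K" for i
      using not_less_Least[of i "\<lambda>K. \<bar>of_int n\<bar> \<le> Q K"] that unfolding K_def by auto
    have Q1: "Q i \<le> Q (Suc i)" for i
    proof -
      have "u (Suc i) * Q (Suc i) \<le> 1 * Q (Suc i)"
        using u_range[of "Suc i"] Q_pos[of "Suc i"] by (intro mult_right_mono) auto
      thus ?thesis unfolding Q_Suc by (simp del: qden.simps)
    qed
    have mono: "Q i \<le> Q l" if "i \<le> l" for i l using lift_Suc_mono_le[of Q, OF Q1 that] .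
    have "\<not> K \<le> 2" using mono[of K 2] K n by (auto simp del: qden.simps)
    then obtain k where k: "K = k + 2" "k \<ge> 1" by (intro that[of "K - 2"]) auto
    define m where "m = round (of_int n * \<alpha> - \<gamma>)"
    obtain M N where MN: "odd M" "odd N"
      "2 * of_int n = Q K * (x K + of_int M + of_int N * u K)"
      "2 * (of_int n * \<alpha> - of_int m - \<gamma>) = D K * (- z K + of_int M * v K + of_int N)"
      using grid_coords[of n K m] by blast
    define A where "A = x K + of_int M + of_int N * u K"
    have nA: "2 * \<bar>of_int n\<bar> = Q K * \<bar>A\<bar>"
      using MN(3) Q_pos[of K] unfolding A_def[symmetric]
      by (metis abs_mult abs_numeral abs_of_pos)
    have A2: "\<bar>A\<bar> \<le> 2"
    proof -
      have "Q K * \<bar>A\<bar> \<le> Q K * 2" using nA K by linarith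
      thus ?thesis using Q_pos[of K] by simp
    qed
    have A1: "2 * u K \<le> \<bar>A\<bar>"
    proof -
      have "Q (k+1) < \<bar>of_int n\<bar>" using Kl[of "k+1"] k by simp
      moreover have "u K * Q K = Q (k+1)" using Q_Suc[of "k+1"] k by simp
      ultimately have "Q K * (2 * u K) \<le> Q K * \<bar>A\<bar>" using nA by (simp add: mult.commute)
      thus ?thesis using Q_pos[of K] by simp
    qed
    have "r * (1 - u K * v K) \<le> \<bar>A\<bar> * \<bar>- z K + of_int M * v K + of_int N\<bar>"
      using level_bound[OF k(2) MN(1,2)] A1 A2 unfolding A_def k(1) by blast
    also have "\<dots> = 4 * \<bar>of_int n * (of_int n * \<alpha> - of_int m - \<gamma>)\<bar> * (1 - u K * v K)"
      using grid_product[OF MN(3,4)] unfolding A_def by simp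
    finally have "r \<le> 4 * \<bar>of_int n * (of_int n * \<alpha> - of_int m - \<gamma>)\<bar>"
      using uv_range[of K] by simp
    moreover have "dnint (real_of_int n * \<alpha> - \<gamma>) = \<bar>of_int n * \<alpha> - of_int m - \<gamma>\<bar>"
      unfolding dnint_def m_def[symmetric] by (simp add: algebra_simps)
    ultimately show ?thesis by (simp add: abs_mult)
  qed
  have "finite {n. \<not> r / 4 \<le> \<bar>real_of_int n\<bar> * dnint (real_of_int n * \<alpha> - \<gamma>)}"
  proof (rule finite_subset)
    show "{n. \<not> r / 4 \<le> \<bar>real_of_int n\<bar> * dnint (real_of_int n * \<alpha> - \<gamma>)} \<subseteq> {-\<lceil>Q 2\<rceil>..\<lceil>Q 2\<rceil>}"
    proof
      fix n assume "n \<in> {n. \<not> r / 4 \<le> \<bar>real_of_int n\<bar> * dnint (real_of_int n * \<alpha> - \<gamma>)}"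
      hence "\<not> Q 2 < \<bar>of_int n\<bar>" using bound by blast
      thus "n \<in> {-\<lceil>Q 2\<rceil>..\<lceil>Q 2\<rceil>}" using le_of_int_ceiling[of "Q 2"] by (simp del: qden.simps) linarith
    qed
  qed simp
  hence "eventually (\<lambda>n. ereal (r / 4) \<le> ereal (\<bar>real_of_int n\<bar> * dnint (real_of_int n * \<alpha> - \<gamma>))) cofinite"
    by (simp add: eventually_cofinite)
  thus ?thesis unfolding Mval_def by (rule Liminf_bounded)
qed

text \<open>Otherwise the fixed grid point with n = b would have second coordinate 0 at every level.
  As N is odd, this forces |M| >= 3, so |b| >= Q_k / 2 for all large k.\<close>

lemma not_in_lattice: "\<not> (\<exists>a b::int. \<gamma> = of_int a + of_int b * \<alpha>)"
proof
  assume "\<exists>a b::int. \<gamma> = of_int a + of_int b * \<alpha>"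
  then obtain a' b :: int where g: "\<gamma> = of_int a' + of_int b * \<alpha>" by blast
  obtain K0 where K0: "2 * \<bar>of_int b\<bar> + 1 < (2::real) ^ K0" using real_arch_pow[of 2] by auto
  define k where "k = Suc K0"
  obtain M N where MN: "odd M" "odd N"
      "2 * of_int b = Q k * (x k + of_int M + of_int N * u k)"
      "2 * (of_int b * \<alpha> - of_int (-a') - \<gamma>) = D k * (- z k + of_int M * v k + of_int N)"
    using grid_coords[of b k "-a'"] by blast
  have z: "\<bar>z k\<bar> \<le> 4 * e" and x: "\<bar>x k\<bar> \<le> 4 * e" using z_small x_small[of K0] unfolding k_def by auto
  have uk: "0 \<le> u k" "u k \<le> 1" using u_range[of k] by auto
  have Y: "- z k + of_int M * v k + of_int N = 0" using MN(4) D_pos[of k] g by simp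
  have N1: "1 \<le> \<bar>real_of_int N\<bar>" using MN(2) by (cases "N = 0") (simp, linarith)
  have Mv: "\<bar>of_int M * v k\<bar> = \<bar>real_of_int M\<bar> * v k" using v_bounds(1)[of k] by (simp add: abs_mult)
  have "\<bar>real_of_int M\<bar> * v k \<le> \<bar>real_of_int M\<bar> * (1/4)"
    using v_bounds(1,2)[of k] e_small by (intro mult_left_mono) auto
  hence N2: "\<bar>real_of_int N\<bar> \<le> \<bar>real_of_int M\<bar> / 4 + 4 * e" using Y z Mv by linarith
  have M3: "3 \<le> \<bar>real_of_int M\<bar>" using N1 N2 e_small by linarith
  have "\<bar>of_int N * u k\<bar> \<le> \<bar>real_of_int N\<bar> * 1" unfolding abs_mult using uk by (intro mult_mono) auto
  hence "1 \<le> \<bar>x k + of_int M + of_int N * u k\<bar>" using N2 M3 x e_small by linarith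
  hence "Q k * 1 \<le> Q k * \<bar>x k + of_int M + of_int N * u k\<bar>" using Q_pos[of k] by (intro mult_left_mono) auto
  also have "\<dots> = \<bar>2 * of_int b\<bar>" unfolding MN(3) using Q_pos[of k] by (simp add: abs_mult)
  finally have "Q k \<le> 2 * \<bar>of_int b\<bar>" by (simp del: qden.simps)
  moreover have "(2::real) ^ K0 \<le> 2 ^ k" unfolding k_def by simp
  ultimately show False using K0 Q_ge[of k] by linarith
qed

end

section \<open>The extremal periodic shift\<close>

context ncf begin

text \<open>The recursion has no initial value; iterating it forward yields the series of t_(k+n)
  with weights v_k ... v_(k+n), which converges geometrically.\<close>

lemma bounded_solution:
  fixes t :: "nat \<Rightarrow> real"
  assumes t: "\<And>k. \<bar>t k\<bar> \<le> 1"
  shows "\<exists>z. \<forall>k. z k = v k * (t k + z (Suc k)) \<and> \<bar>z k\<bar> \<le> 1"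
proof -
  define w where "w k n = (\<Prod>i\<le>n. v (k + i)) * t (k + n)" for k n
  have v_half: "0 \<le> v k" "v k \<le> 1/2" for k
    using v_bounds(1,2)[of k] e_small by linarith+
  have w_le: "\<bar>w k n\<bar> \<le> (1/2) ^ Suc n" for k n
  proof -
    have "(\<Prod>i\<le>n. v (k + i)) \<le> (\<Prod>i\<le>n. 1/2)"
      using v_half by (intro prod_mono) auto
    moreover have "0 \<le> (\<Prod>i\<le>n. v (k + i))" using v_half by (intro prod_nonneg) auto
    ultimately have "\<bar>\<Prod>i\<le>n. v (k + i)\<bar> * \<bar>t (k + n)\<bar> \<le> (1/2) ^ Suc n * 1"
      using t by (intro mult_mono) auto
    thus ?thesis by (simp add: w_def abs_mult)
  qed
  have geo: "(\<lambda>n. (1/2::real) ^ Suc n) sums 1" using power_half_series .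
  have sw: "summable (w k)" for k
    by (rule summable_comparison_test'[OF sums_summable[OF geo], of 0]) (use w_le in simp)
  have step: "(\<Sum>n. w k n) = v k * (t k + (\<Sum>n. w (Suc k) n))" for k
  proof -
    have "w k (Suc n) = v k * w (Suc k) n" for n
      unfolding w_def prod.atMost_Suc_shift by simp
    hence "(\<Sum>n. w k (Suc n)) = v k * (\<Sum>n. w (Suc k) n)"
      using suminf_mult[OF sw[of "Suc k"]] by simp
    moreover have "(\<Sum>n. w k n) = w k 0 + (\<Sum>n. w k (Suc n))"
      using suminf_split_head[OF sw[of k]] by simp
    moreover have "w k 0 = v k * t k" by (simp add: w_def)
    ultimately show ?thesis by (simp add: algebra_simps)
  qed
  have "\<bar>\<Sum>n. w k n\<bar> \<le> 1" for k
  proof -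
    have "norm (\<Sum>n. w k n) \<le> (\<Sum>n. (1/2::real) ^ Suc n)"
      using w_le by (intro norm_suminf_le sums_summable[OF geo]) simp
    thus ?thesis using sums_unique[OF geo] by simp
  qed
  with step show ?thesis by (intro exI[of _ "\<lambda>k. \<Sum>n. w k n"]) blast
qed

text \<open>Odd exactly at the digits R. Neighbouring values add up to 0 at digits of equal parity
  and to 1 or -1 elsewhere.\<close>

definition optimal :: "nat \<Rightarrow> int" where
  "optimal k = [1, -1, 0, 1, 0, 0, 1, 0, 0, -1, 0] ! (k mod 11)"

lemma exists_good_shift:
  "\<exists>\<gamma>. \<not> (\<exists>a b::int. \<gamma> = of_int a + of_int b * \<alpha>)
     \<and> ereal ((1 - 3 * e + 4 * e^2 - 300000 * e^3) / 4) \<le> Mval \<alpha> \<gamma>"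
proof -
  have s_le: "\<bar>optimal k\<bar> \<le> 1" for k
    using mod_11_cases[of k] unfolding optimal_def by (elim disjE) simp_all
  hence "\<bar>real_of_int (optimal k)\<bar> \<le> 1" for k by (metis of_int_abs of_int_le_1_iff)
  from bounded_solution[of "\<lambda>k. of_int (optimal k)", OF this] obtain z where
    z: "\<And>k. z k = v k * (of_int (optimal k) + z (Suc k))" "\<And>k. \<bar>z k\<bar> \<le> 1" by blast
  have m: "(k + i) mod 11 = (k mod 11 + i) mod 11" for k i :: nat by (simp add: mod_simps)
  have opt: "optimal (k + i) = [1, -1, 0, 1, 0, 0, 1, 0, 0, -1, 0] ! ((k mod 11 + i) mod 11)"
    and ds: "d (k + i) = [0,0,1,0,1,1,0,1,1,0,1] ! ((k mod 11 + i) mod 11)" for k i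
    unfolding optimal_def d_mod by (subst m, rule refl)+
  \<comment> \<open>Solves the initial condition of \<open>cell\<close> with j = 0: the sequence s
    determines its bounded z, and \<open>z 0\<close> determines the shift.\<close>
  define \<gamma> where "\<gamma> = (z 0 - 1 + \<alpha>) / 2"
  interpret bounded_cell R \<alpha> \<gamma> optimal z 0
  proof
    show "even (optimal k - a k)" for k
      using mod_11_cases[of k] odd_R unfolding optimal_def a_eq d_mod by (elim disjE) simp_all
    show "z k = v k * (of_int (optimal k) + z (Suc k))" for k by (rule z)
    show "z 0 = 1 - \<alpha> + 2 * \<gamma> - 2 * of_int 0" by (simp add: \<gamma>_def field_simps)
    show "\<bar>optimal k\<bar> \<le> 1" for k by (rule s_le)
    show "\<bar>z k\<bar> \<le> 1" for k by (rule z)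
    show "\<bar>optimal k + optimal (Suc k)\<bar> \<le> 1" for k
      using mod_11_cases[of k] unfolding Suc_eq_plus1 opt optimal_def[of k] by (elim disjE) simp_all
    show "0 \<le> d (k+1) + d (k+2) + optimal (k+1) * optimal (k+2) - 1
        - c * (optimal k + optimal (k+3) - d (k+1) * optimal (k+1) - d (k+2) * optimal (k+2))"
      if "c = 1 \<or> c = -1" "c * (optimal (k+1) + optimal (k+2)) = 1" for c k
      using mod_11_cases[of k] that unfolding opt ds optimal_def[of k] by (elim disjE) simp_all
  qed
  show ?thesis using not_in_lattice Mval_ge unfolding r_def by blast
qed

end

section \<open>The upper bound\<close>

text \<open>At a level where |p + q| = 1, the coefficient of e^2 in the smaller vertex product is at
  least 5.\<close>

definition admissible :: "int \<Rightarrow> int \<Rightarrow> int \<Rightarrow> int \<Rightarrow> int \<Rightarrow> int \<Rightarrow> bool" where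
  "admissible d1 d2 s2 p q s1 \<longleftrightarrow> \<bar>p + q\<bar> = 1 \<longrightarrow>
     1 \<le> d1 + d2 + p * q - 1 - (p + q) * (s2 + s1 - d1 * p - d2 * q)"

text \<open>Here w sits at an odd digit, b at an adjacent even one, and t is the sum of the two
  outer neighbours. With c = w + b the condition reads (c b - 1)^2 <= -c t, and |t + c| <= 2 caps
  the right side by 3. Hence the even number c b is 0 or 2.\<close>

lemma mixed_pair:
  fixes b w t :: int
  assumes "odd w" "even b" "\<bar>w + b\<bar> \<le> 1" "\<bar>t + (w + b)\<bar> \<le> 2"
    and adm: "1 \<le> w * b - (w + b) * (t - b)"
  shows "(w = 1 \<or> w = -1) \<and> (b = 0 \<or> b = -2 * w)"
proof -
  have "odd (w + b)" using assms by simp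
  hence "w + b = 1 \<or> w + b = -1" using assms(3) by presburger
  then obtain c where c: "c = 1 \<or> c = -1" "w = c - b" by (metis add_diff_cancel_right')
  have "(c * b - 1)^2 \<le> 3"
  proof -
    have "w * b = c * b - b * b" unfolding c(2) by (simp add: algebra_simps)
    moreover have "w + b = c" using c(2) by simp
    ultimately have "1 \<le> c * b - b * b - c * (t - b)" "\<bar>t + c\<bar> \<le> 2" using adm assms(4) by simp_all
    thus ?thesis using c(1) by (elim disjE) (simp_all add: power2_eq_square algebra_simps)
  qed
  hence "\<bar>c * b - 1\<bar> < 2" using abs_le_square_iff[of 2 "c * b - 1"] by fastforce
  moreover have "even (c * b)" using assms(2) by simp
  moreover have "y = 0 \<or> y = 2" if "\<bar>y - 1\<bar> < 2" "even y" for y :: int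
    using that by presburger
  ultimately have "c * b = 0 \<or> c * b = 2" by blast
  thus ?thesis using c by auto
qed

text \<open>The window 0, ..., 12 is one period and the first two terms of the next. Its mixed
  junctions fall under \<open>mixed_pair\<close>; at junctions of equal parity the sum is 0.\<close>

lemma no_admissible_period:
  fixes S :: "nat \<Rightarrow> int" and d :: "nat \<Rightarrow> int"
  assumes d: "\<And>i. d i = [0,0,1,0,1,1,0,1,1,0,1] ! (i mod 11)"
    and par: "\<And>i. even (S i) \<longleftrightarrow> d i = 1"
    and adj: "\<And>i. \<bar>S i + S (i+1)\<bar> \<le> 1"
    and adm: "\<And>i. admissible (d (i+1)) (d (i+2)) (S i) (S (i+1)) (S (i+2)) (S (i+3))"
  shows False
proof -
  have dn: "d 0 = 0" "d 1 = 0" "d (Suc 0) = 0" "d 2 = 1" "d 3 = 0" "d 4 = 1" "d 5 = 1" "d 6 = 0"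
    "d 7 = 1" "d 8 = 1" "d 9 = 0" "d 10 = 1" "d 11 = 0" "d 12 = 0" by (simp_all add: d)
  have p: "odd (S 0)" "odd (S 1)" "even (S 2)" "odd (S 3)" "even (S 4)" "even (S 5)" "odd (S 6)"
    "even (S 7)" "even (S 8)" "odd (S 9)" "even (S 10)" "odd (S 11)" "odd (S 12)"
    by (simp_all add: par dn)
  have adj': "\<bar>S i + S l\<bar> \<le> 1" if "l = i + 1" for i l using adj[of i] that by simp
  have a: "\<bar>S 0 + S 1\<bar> \<le> 1" "\<bar>S 1 + S 2\<bar> \<le> 1" "\<bar>S 2 + S 3\<bar> \<le> 1" "\<bar>S 3 + S 4\<bar> \<le> 1" "\<bar>S 4 + S 5\<bar> \<le> 1"
    "\<bar>S 5 + S 6\<bar> \<le> 1" "\<bar>S 6 + S 7\<bar> \<le> 1" "\<bar>S 7 + S 8\<bar> \<le> 1" "\<bar>S 8 + S 9\<bar> \<le> 1" "\<bar>S 9 + S 10\<bar> \<le> 1"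
    "\<bar>S 10 + S 11\<bar> \<le> 1" "\<bar>S 11 + S 12\<bar> \<le> 1"
    by (rule adj'; simp)+
  \<comment> \<open>At a mixed junction exactly one digit exceeds R, which cancels the -1 in
    \<open>admissible\<close>. The odd entry is written first.\<close>
  have m: "1 \<le> S 1 * S 2 - (S 1 + S 2) * (S 0 + S 3 - S 2)"
    "1 \<le> S 3 * S 2 - (S 3 + S 2) * (S 1 + S 4 - S 2)"
    "1 \<le> S 3 * S 4 - (S 3 + S 4) * (S 2 + S 5 - S 4)"
    "1 \<le> S 6 * S 5 - (S 6 + S 5) * (S 4 + S 7 - S 5)"
    "1 \<le> S 6 * S 7 - (S 6 + S 7) * (S 5 + S 8 - S 7)"
    "1 \<le> S 9 * S 8 - (S 9 + S 8) * (S 7 + S 10 - S 8)"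
    "1 \<le> S 9 * S 10 - (S 9 + S 10) * (S 8 + S 11 - S 10)"
    "1 \<le> S 11 * S 10 - (S 11 + S 10) * (S 9 + S 12 - S 10)"
  proof -
    have odd1: "\<bar>p + q\<bar> = 1" if "odd (p + q)" "\<bar>p + q\<bar> \<le> 1" for p q :: int
      using that by presburger
    have ad: "1 \<le> d i1 + d i2 + S i1 * S i2 - 1 - (S i1 + S i2) * (S i + S i3 - d i1 * S i1 - d i2 * S i2)"
      if "i1 = i + 1" "i2 = i + 2" "i3 = i + 3" "odd (S i1 + S i2)" for i i1 i2 i3
      using adm[of i] odd1[of "S i1" "S i2"] adj'[of i2 i1] that by (simp add: admissible_def)
    show "1 \<le> S 1 * S 2 - (S 1 + S 2) * (S 0 + S 3 - S 2)"
      using ad[where i = 0 and ?i1.0 = 1 and ?i2.0 = 2 and ?i3.0 = 3] p(2,3) dn by (simp add: ac_simps)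
    show "1 \<le> S 3 * S 2 - (S 3 + S 2) * (S 1 + S 4 - S 2)"
      using ad[where i = 1 and ?i1.0 = 2 and ?i2.0 = 3 and ?i3.0 = 4] p(3,4) dn by (simp add: ac_simps)
    show "1 \<le> S 3 * S 4 - (S 3 + S 4) * (S 2 + S 5 - S 4)"
      using ad[where i = 2 and ?i1.0 = 3 and ?i2.0 = 4 and ?i3.0 = 5] p(4,5) dn by (simp add: ac_simps)
    show "1 \<le> S 6 * S 5 - (S 6 + S 5) * (S 4 + S 7 - S 5)"
      using ad[where i = 4 and ?i1.0 = 5 and ?i2.0 = 6 and ?i3.0 = 7] p(6,7) dn by (simp add: ac_simps)
    show "1 \<le> S 6 * S 7 - (S 6 + S 7) * (S 5 + S 8 - S 7)"
      using ad[where i = 5 and ?i1.0 = 6 and ?i2.0 = 7 and ?i3.0 = 8] p(7,8) dn by (simp add: ac_simps)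
    show "1 \<le> S 9 * S 8 - (S 9 + S 8) * (S 7 + S 10 - S 8)"
      using ad[where i = 7 and ?i1.0 = 8 and ?i2.0 = 9 and ?i3.0 = 10] p(9,10) dn by (simp add: ac_simps)
    show "1 \<le> S 9 * S 10 - (S 9 + S 10) * (S 8 + S 11 - S 10)"
      using ad[where i = 8 and ?i1.0 = 9 and ?i2.0 = 10 and ?i3.0 = 11] p(10,11) dn by (simp add: ac_simps)
    show "1 \<le> S 11 * S 10 - (S 11 + S 10) * (S 9 + S 12 - S 10)"
      using ad[where i = 9 and ?i1.0 = 10 and ?i2.0 = 11 and ?i3.0 = 12] p(11,12) dn by (simp add: ac_simps)
  qed
  have b: "(S 1 = 1 \<or> S 1 = -1) \<and> (S 2 = 0 \<or> S 2 = -2 * S 1)"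
    "(S 3 = 1 \<or> S 3 = -1) \<and> (S 2 = 0 \<or> S 2 = -2 * S 3)"
    "(S 3 = 1 \<or> S 3 = -1) \<and> (S 4 = 0 \<or> S 4 = -2 * S 3)"
    "(S 6 = 1 \<or> S 6 = -1) \<and> (S 5 = 0 \<or> S 5 = -2 * S 6)"
    "(S 6 = 1 \<or> S 6 = -1) \<and> (S 7 = 0 \<or> S 7 = -2 * S 6)"
    "(S 9 = 1 \<or> S 9 = -1) \<and> (S 8 = 0 \<or> S 8 = -2 * S 9)"
    "(S 9 = 1 \<or> S 9 = -1) \<and> (S 10 = 0 \<or> S 10 = -2 * S 9)"
    "(S 11 = 1 \<or> S 11 = -1) \<and> (S 10 = 0 \<or> S 10 = -2 * S 11)"
    subgoal by (rule mixed_pair[OF p(2,3) _ _ m(1)]) (use a(1,2,3) in linarith)+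
    subgoal by (rule mixed_pair[OF p(4,3) _ _ m(2)]) (use a(2,3,4) in linarith)+
    subgoal by (rule mixed_pair[OF p(4,5) _ _ m(3)]) (use a(3,4,5) in linarith)+
    subgoal by (rule mixed_pair[OF p(7,6) _ _ m(4)]) (use a(5,6,7) in linarith)+
    subgoal by (rule mixed_pair[OF p(7,8) _ _ m(5)]) (use a(6,7,8) in linarith)+
    subgoal by (rule mixed_pair[OF p(10,9) _ _ m(6)]) (use a(8,9,10) in linarith)+
    subgoal by (rule mixed_pair[OF p(10,11) _ _ m(7)]) (use a(9,10,11) in linarith)+
    subgoal by (rule mixed_pair[OF p(12,11) _ _ m(8)]) (use a(10,11,12) in linarith)+
    done
  have e: "S 0 = - S 1" "S 5 = - S 4" "S 8 = - S 7" "S 12 = - S 11"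
  proof -
    have ev: "w = - t" if "even (t + w)" "\<bar>t + w\<bar> \<le> 1" for t w :: int
      using that by presburger
    show "S 5 = - S 4" using p a(5) by (intro ev) simp_all
    show "S 8 = - S 7" using p a(8) by (intro ev) simp_all
    show "S 12 = - S 11" using p a(12) by (intro ev) simp_all
    show "S 0 = - S 1" using p a(1) by (intro ev) (simp_all add: add.commute)
  qed
  \<comment> \<open>S 2 = -2 S 1 would force S 3 = S 1 and give the first condition the value 0; S 4
    = 0 does the same to the third.\<close>
  have f1: "S 2 = 0 \<and> S 3 = - S 1 \<and> S 4 = 2 * S 1"
    using b(1,2,3) a(3) m(1,2,3) unfolding e by (elim conjE disjE) simp_all
  have f2: "S 6 = S 1 \<and> S 7 = 0"
    using b(1,4,5) f1 m(4,5) unfolding e by (elim conjE disjE) simp_all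
  have f3: "S 10 = -2 * S 9"
    using b(6,7) f2 m(6) unfolding e by (elim conjE disjE) simp_all
  \<comment> \<open>Now S 11 = S 9 as well, and the last condition has the value 0 instead of at
    least 1.\<close>
  show False
    using b(7,8) f2 f3 m(7,8) unfolding e by (elim conjE disjE) simp_all
qed

text \<open>What a shift with \<open>Mval\<close> above the claimed upper bound would provide; the
  locale exists to be refuted.\<close>

locale near_cell = cell +
  assumes z_le: "\<bar>z k\<bar> \<le> 1"
    and outside: "\<not> (\<exists>a b::int. \<gamma> = of_int a + of_int b * \<alpha>)"
    and large: "finite {n. \<not> (1 - 3 * e + 4 * e^2 + 300000 * e^3) / 4
      \<le> \<bar>real_of_int n\<bar> * dnint (real_of_int n * \<alpha> - \<gamma>)}"
begin

definition r :: real where "r = 1 - 3 * e + 4 * e^2 + 300000 * e^3"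

lemma r_ge: "1 - 3 * e \<le> r"
  unfolding r_def using e_pos by simp

text \<open>Although s_k may be of size R, s_k = z_k / v_k - z_(k+1) is governed by z, and u_(k+1) /
  v_k <= 1 + u_(k+1) because both ratios involve the same digit a_k. Errors do not accumulate, since
  x_k enters with the small factor u_(k+1).\<close>

lemma x_le: "\<bar>x k\<bar> \<le> 1 + 8 * e"
proof (induction k)
  case (Suc k)
  let ?u = "u (Suc k)"
  have u: "0 < ?u" "?u \<le> 2 * e" using u_Suc_bounds[of k] by simp_all
  have v: "0 < v k" using v_bounds[of k] by simp
  have iv: "1 / v k = 1/e + of_int (d k) - v (Suc k)" using v_rec'[of k] v by (simp add: field_simps)
  have iu: "1 / ?u = 1/e + of_int (d k) - u k" using u_rec'[of k] u by (simp add: field_simps)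
  have "?u * (1 / v k) \<le> ?u * (1 / ?u + 1)"
    using iv iu u u_range[of k] v_range[of "Suc k"] by (intro mult_left_mono) linarith+
  also have "\<dots> = 1 + ?u" using u by (simp add: field_simps)
  finally have uv: "?u * (1 / v k) \<le> 1 + ?u" .
  have sz: "of_int (s k) = z k * (1 / v k) - z (Suc k)" using z_rec[of k] v by (simp add: field_simps)
  have "\<bar>?u * (z k * (1 / v k))\<bar> = \<bar>z k\<bar> * (?u * (1 / v k))" using u v by (simp add: abs_mult)
  also have "\<dots> \<le> 1 * (1 + ?u)" using z_le[of k] uv u v by (intro mult_mono) auto
  finally have t1: "\<bar>?u * (z k * (1 / v k))\<bar> \<le> 1 + ?u" by simp
  have t2: "\<bar>?u * z (Suc k)\<bar> \<le> ?u * 1" unfolding abs_mult using u z_le by (intro mult_mono) auto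
  have t3: "\<bar>?u * x k\<bar> \<le> ?u * (1 + 8 * e)" unfolding abs_mult using u Suc by (intro mult_mono) auto
  have t4: "?u * (1 + 8 * e) \<le> ?u * 2" using u e_small by (intro mult_left_mono) auto
  have "e^2 \<le> e * (1/1000000)" using e_pos e_small unfolding power2_eq_square by (intro mult_left_mono) auto
  hence u3: "?u \<le> 11/10 * e" using u_Suc_bounds(3)[of k] e_pos by linarith
  have "x (Suc k) = ?u * (z k * (1 / v k)) - ?u * z (Suc k) + ?u * x k"
    unfolding x_Suc sz by (simp add: algebra_simps)
  thus ?case using t1 t2 t3 t4 u3 by linarith
qed (use e_pos in simp)

text \<open>The vertices escape the finite exceptional set through their second coordinate: it tends
  to 0 with D_k, whereas gamma outside Z + alpha Z keeps the distance to the nearest integer above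
  some delta on that set.\<close>

lemma eventually_far:
  obtains k0 where "\<And>k c. k \<ge> k0 \<Longrightarrow> c = 1 \<or> c = -1 \<Longrightarrow>
    r * (1 - u k * v k) \<le> \<bar>1 - u k + c * x k\<bar> * \<bar>1 - v k + c * z k\<bar>"
proof -
  define B where "B = {n. \<not> r / 4 \<le> \<bar>real_of_int n\<bar> * dnint (real_of_int n * \<alpha> - \<gamma>)}"
  have fB: "finite B" using large unfolding B_def r_def .
  \<comment> \<open>The inserted 1 covers an empty exceptional set.\<close>
  define \<delta> where "\<delta> = Min (insert 1 ((\<lambda>n. dnint (real_of_int n * \<alpha> - \<gamma>)) ` B))"
  have pos: "0 < dnint (real_of_int n * \<alpha> - \<gamma>)" for n :: int
  proof (rule ccontr)
    assume "\<not> 0 < dnint (real_of_int n * \<alpha> - \<gamma>)"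
    hence "real_of_int n * \<alpha> - \<gamma> = of_int (round (real_of_int n * \<alpha> - \<gamma>))"
      unfolding dnint_def by simp
    hence "\<gamma> = of_int (- round (real_of_int n * \<alpha> - \<gamma>)) + of_int n * \<alpha>" by simp
    thus False using outside by blast
  qed
  have d0: "0 < \<delta>" unfolding \<delta>_def using fB pos by (subst Min_gr_iff) auto
  have dB: "\<delta> \<le> dnint (real_of_int n * \<alpha> - \<gamma>)" if "n \<in> B" for n
    unfolding \<delta>_def using fB that by (intro Min_le) auto
  obtain k0 where k0: "(1/2::real) ^ k0 < \<delta> / 2" using real_arch_pow_inv[of "\<delta>/2" "1/2"] d0 by auto
  show ?thesis
  proof (rule that[of k0])
    fix k :: nat and c :: real
    assume k: "k \<ge> k0" and c: "c = 1 \<or> c = -1"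
    then obtain M :: int where M: "c = of_int M" "M = 1 \<or> M = -1" by (metis of_int_1 of_int_minus)
    have "odd M" "odd (- M)" using M by auto
    from grid_point[OF this, of k] obtain n m :: int where
      nm: "2 * of_int n = Q k * (x k + of_int M + of_int (-M) * u k)"
        "2 * (of_int n * \<alpha> - of_int m - \<gamma>) = D k * (- z k + of_int M * v k + of_int (-M))" by blast
    have A: "\<bar>x k + of_int M + of_int (-M) * u k\<bar> = \<bar>1 - u k + c * x k\<bar>"
      and B': "\<bar>- z k + of_int M * v k + of_int (-M)\<bar> = \<bar>1 - v k + c * z k\<bar>"
      using M by (auto simp: abs_if)
    have "\<bar>1 - v k + c * z k\<bar> \<le> 3" using v_range[of k] z_le[of k] c by auto
    hence Y3: "D k * \<bar>1 - v k + c * z k\<bar> \<le> D k * 3" using D_pos[of k] by (intro mult_left_mono) auto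
    have "2 * \<bar>of_int n * \<alpha> - of_int m - \<gamma>\<bar> = D k * \<bar>1 - v k + c * z k\<bar>"
      using arg_cong[OF nm(2), of abs] D_pos[of k] unfolding abs_mult B' by simp
    hence "2 * \<bar>of_int n * \<alpha> - of_int m - \<gamma>\<bar> \<le> D k * 3" using Y3 by simp
    moreover have "D k \<le> (1/2) ^ k0"
      by (rule order_trans[OF D_le power_decreasing[OF k]]) auto
    moreover have "y < \<delta>" if "2 * y \<le> t * 3" "t \<le> p" "p < \<delta> / 2" for y t p :: real
      using that d0 by linarith
    ultimately have small: "\<bar>of_int n * \<alpha> - of_int m - \<gamma>\<bar> < \<delta>" using k0 by blast
    have dn: "dnint (of_int n * \<alpha> - \<gamma>) \<le> \<bar>of_int n * \<alpha> - of_int m - \<gamma>\<bar>"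
      unfolding dnint_def using round_diff_minimal[of "of_int n * \<alpha> - \<gamma>" m] by (simp add: algebra_simps)
    hence "n \<notin> B" using dB[of n] small by auto
    hence "r / 4 \<le> \<bar>of_int n\<bar> * dnint (of_int n * \<alpha> - \<gamma>)" unfolding B_def by simp
    also have "\<dots> \<le> \<bar>of_int n\<bar> * \<bar>of_int n * \<alpha> - of_int m - \<gamma>\<bar>" using dn by (intro mult_left_mono) auto
    finally have "r \<le> 4 * \<bar>of_int n * (of_int n * \<alpha> - of_int m - \<gamma>)\<bar>" by (simp add: abs_mult)
    hence "r * (1 - u k * v k) \<le> 4 * \<bar>of_int n * (of_int n * \<alpha> - of_int m - \<gamma>)\<bar> * (1 - u k * v k)"
      using uv_range[of k] by (intro mult_right_mono) auto
    thus "r * (1 - u k * v k) \<le> \<bar>1 - u k + c * x k\<bar> * \<bar>1 - v k + c * z k\<bar>"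
      using grid_product[OF nm] unfolding A B' by simp
  qed
qed

lemma impossible: False
proof -
  obtain k1 where far: "\<And>k c. k \<ge> k1 \<Longrightarrow> c = 1 \<or> c = -1 \<Longrightarrow>
    r * (1 - u k * v k) \<le> \<bar>1 - u k + c * x k\<bar> * \<bar>1 - v k + c * z k\<bar>"
    using eventually_far by blast
  \<comment> \<open>One level later, because \<open>u 0 = 0\<close> is not positive.\<close>
  define k0 where "k0 = Suc k1"
  have u: "0 < u k" "u k \<le> 2 * e" "\<bar>u k - e\<bar> \<le> 2 * e^2" if "k \<ge> k0" for k
    using u_Suc_bounds[of "k - 1"] that unfolding k0_def by auto
  have sq: "(x k)^2 \<le> 8 * e" "(z k)^2 \<le> 8 * e" if "k \<ge> k0" for k
    using vertex_bounds_imp_small[OF e_pos e_small u(1,2)[OF that] v_bounds(1,2)[of k] x_le z_le r_ge]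
      far[of k 1] far[of k "-1"] that unfolding k0_def by simp_all
  have small: "\<bar>x k\<bar> \<le> 3/1000" "\<bar>z k\<bar> \<le> 3/1000" if "k \<ge> k0" for k
  proof -
    have "\<bar>y\<bar> \<le> 3/1000" if "y^2 \<le> 8 * e" for y :: real
    proof -
      have "y^2 \<le> (3/1000)^2" using that e_small by (simp add: power2_eq_square)
      thus ?thesis by (metis abs_le_square_iff abs_of_nonneg divide_nonneg_nonneg zero_le_numeral)
    qed
    thus "\<bar>x k\<bar> \<le> 3/1000" "\<bar>z k\<bar> \<le> 3/1000" using sq[OF that] by auto
  qed
  have vert: "r * (1 - u k * v k) \<le> (1 - u k + x k) * (1 - v k + z k)"
    "r * (1 - u k * v k) \<le> (1 - u k - x k) * (1 - v k - z k)" if k: "k \<ge> k0" for k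
  proof -
    have "0 \<le> 1 - u k + x k" "0 \<le> 1 - v k + z k" "0 \<le> 1 - u k - x k" "0 \<le> 1 - v k - z k"
      using small[OF k] u(2)[OF k] v_bounds(2)[of k] e_small by linarith+
    thus "r * (1 - u k * v k) \<le> (1 - u k + x k) * (1 - v k + z k)"
      "r * (1 - u k * v k) \<le> (1 - u k - x k) * (1 - v k - z k)"
      using far[of k 1] far[of k "-1"] k unfolding k0_def by simp_all
  qed
  have L: "\<bar>x k * (1 - v k) + z k * (1 - u k)\<bar> \<le> e + 7 * e^2 + x k * z k" if "k \<ge> k0" for k
    by (rule vertex_bounds_imp_linear[OF e_pos e_small u(1,3)[OF that] v_bounds(1,3) r_ge vert[OF that]])
  have adj: "\<bar>s k + s (k+1)\<bar> \<le> 1" if k: "k \<ge> k0" for k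
  proof -
    have k': "Suc k \<ge> k0" "Suc (Suc k) \<ge> k0" using k by simp_all
    have iv: "1 / v (Suc k) = 1/e + of_int (d (Suc k)) - v (Suc (Suc k))"
      using v_rec'[of "Suc k"] v_bounds(1)[of "Suc k"] by (simp add: field_simps)
    have iu: "1 / u (Suc k) = 1/e + of_int (d k) - u k"
      using u_rec'[of k] u(1)[OF k'(1)] by (simp add: field_simps)
    have iuv: "1 / u (Suc k) \<le> 1 / e + 1" "\<bar>1 / u (Suc k) - 1 / v (Suc k)\<bar> \<le> 2"
      unfolding iu iv using d_range[of k] d_range[of "Suc k"] u_range[of k] v_range[of "Suc (Suc k)"] by linarith+
    have "\<bar>real_of_int (s k) + of_int (s (Suc k))\<bar> < 2"
      by (rule adjacent_sum_lt_2[OF e_pos e_small u(1,3)[OF k'(1)] v_bounds(1,3) L[OF k'(1)] iuv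
            sq[OF k'(1)] sq(1)[OF k] sq(2)[OF k'(2)] x_Suc z_rec])
    thus ?thesis by simp
  qed
  have xs: "\<bar>x (Suc k)\<bar> \<le> 2 * e * (\<bar>of_int (s k)\<bar> + 1)" "\<bar>z k\<bar> \<le> 2 * e * (\<bar>of_int (s k)\<bar> + 1)"
    if k: "k \<ge> k0" for k
  proof -
    have k': "Suc k \<ge> k0" using k by simp
    have "\<bar>of_int (s k) + x k\<bar> \<le> \<bar>of_int (s k)\<bar> + 1" "\<bar>of_int (s k) + z (Suc k)\<bar> \<le> \<bar>of_int (s k)\<bar> + 1"
      using small[OF k] small[OF k'] by linarith+
    thus "\<bar>x (Suc k)\<bar> \<le> 2 * e * (\<bar>of_int (s k)\<bar> + 1)" "\<bar>z k\<bar> \<le> 2 * e * (\<bar>of_int (s k)\<bar> + 1)"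
      unfolding x_Suc z_rec[of k] abs_mult using u(1,2)[OF k'] v_bounds(1,2)[of k]
      by (intro mult_mono; simp)+
  qed
  have adm: "admissible (d (k+1)) (d (k+2)) (s k) (s (k+1)) (s (k+2)) (s (k+3))" if k: "k \<ge> Suc k0" for k
    unfolding admissible_def
  proof
    assume odd: "\<bar>s (k+1) + s (k+2)\<bar> = 1"
    have kk: "k - 1 \<ge> k0" "k \<ge> k0" "k+1 \<ge> k0" "k+2 \<ge> k0" "k+3 \<ge> k0" "k+4 \<ge> k0" "Suc (k - 1) = k"
      using k by auto
    have adjs: "\<bar>s (k-1) + s k\<bar> \<le> 1" "\<bar>s k + s (k+1)\<bar> \<le> 1" "\<bar>s (k+2) + s (k+3)\<bar> \<le> 1" "\<bar>s (k+3) + s (k+4)\<bar> \<le> 1"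
      using adj[OF kk(1)] adj[OF kk(2)] adj[OF kk(4)] adj[OF kk(5)] kk(7) by (simp_all add: eval_nat_numeral)
    have q: "\<bar>s k\<bar> \<le> \<bar>s (k+2)\<bar> + 2" "\<bar>s (k+3)\<bar> \<le> \<bar>s (k+2)\<bar> + 2"
      using adjs odd by linarith+
    hence qr: "\<bar>real_of_int (s k)\<bar> \<le> \<bar>of_int (s (k+2))\<bar> + 2"
      "\<bar>real_of_int (s (k+3))\<bar> \<le> \<bar>of_int (s (k+2))\<bar> + 2" by linarith+
    have xe: "x (k+2) = u (k+2) * (of_int (s (k+1)) + x (k+1))" using x_Suc[of "k+1"] by simp
    have ze: "z (k+2) = v (k+2) * (of_int (s (k+2)) + z (k+3))"
      using z_rec[of "k+2"] by (simp add: eval_nat_numeral)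
    have mono: "2 * e * (\<bar>real_of_int i\<bar> + 1) \<le> 2 * e * y" if "\<bar>real_of_int i\<bar> + 1 \<le> y" for i y
      using that e_pos by (intro mult_left_mono) auto
    have x1: "\<bar>x (k+1)\<bar> \<le> 2 * e * (\<bar>of_int (s (k+2))\<bar> + 3)"
      using order_trans[OF xs(1)[OF kk(2)] mono] qr(1) by simp
    have z1: "\<bar>z (k+3)\<bar> \<le> 2 * e * (\<bar>of_int (s (k+2))\<bar> + 3)"
      using order_trans[OF xs(2)[OF kk(5)] mono] qr(2) by simp
    have o: "\<bar>real_of_int (s (k+1)) + of_int (s (k+2))\<bar> = 1" using odd by (simp flip: of_int_add of_int_abs)
    have "\<bar>real_of_int (s (k+2))\<bar> < 18"
      by (rule odd_adjacent_imp_bounded[OF e_pos e_small u(1,3)[OF kk(4)] v_bounds(1,3) L[OF kk(4)]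
            small(1)[OF kk(3)] small(2)[OF kk(5)] x1 z1 xe ze o])
    hence q17: "\<bar>s (k+2)\<bar> \<le> 17" by linarith
    \<comment> \<open>17 plus at most 1 per step; s (k-1) is three steps away from s (k+2).\<close>
    have s20: "\<bar>s (k-1)\<bar> \<le> 20" "\<bar>s k\<bar> \<le> 20" "\<bar>s (k+1)\<bar> \<le> 20" "\<bar>s (k+2)\<bar> \<le> 20" "\<bar>s (k+3)\<bar> \<le> 20" "\<bar>s (k+4)\<bar> \<le> 20"
      using q17 odd adjs by linarith+
    have s20r: "\<bar>real_of_int (s (k-1))\<bar> + 1 \<le> 21" "\<bar>real_of_int (s (k+4))\<bar> + 1 \<le> 21"
      using s20(1,6) by linarith+
    have xk: "\<bar>x k\<bar> \<le> 42 * e"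
      using order_trans[OF xs(1)[OF kk(1)] mono[OF s20r(1)]] kk(7) by simp
    have zk: "\<bar>z (k+4)\<bar> \<le> 42 * e"
      using order_trans[OF xs(2)[OF kk(6)] mono[OF s20r(2)]] by simp
    define c where "c = s (k+1) + s (k+2)"
    have c: "c = 1 \<or> c = -1" using odd unfolding c_def by linarith
    define J where "J = d (k+1) + d (k+2) + s (k+1) * s (k+2) - 1
       - (s (k+1) + s (k+2)) * (s k + s (k+3) - d (k+1) * s (k+1) - d (k+2) * s (k+2))"
    have c2: "c * c = 1" using c by auto
    hence cc: "c * (s (k+1) + s (k+2)) = 1" unfolding c_def .
    have Jeq: "d (k+1) + d (k+2) - 2 + s (k+1) * s (k+2)
      + c * (s (k+1) + s (k+2)) - c * (s k + s (k+3) - d (k+1) * s (k+1) - d (k+2) * s (k+2)) = J"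
      unfolding J_def c_def[symmetric] using c2 by simp
    let ?P = "(1 - u (k+2) - of_int c * x (k+2)) * (1 - v (k+2) - of_int c * z (k+2))"
    have "\<bar>?P - (1 - 3 * e + 4 * e^2) * (1 - u (k+2) * v (k+2)) - e^2 * of_int J\<bar>
       \<le> 130000 * e^3"
      using vertex_expand[OF s20(2-5) xk zk c] unfolding Jeq unfolding cc by simp
    moreover have "r * (1 - u (k+2) * v (k+2)) \<le> ?P"
      using vert[OF kk(4)] c by auto
    moreover have "r * (1 - u (k+2) * v (k+2)) = (1 - 3 * e + 4 * e^2) * (1 - u (k+2) * v (k+2))
       + 300000 * e^3 * (1 - u (k+2) * v (k+2))"
      unfolding r_def by algebra
    moreover have "300000 * e^3 * (1/2) \<le> 300000 * e^3 * (1 - u (k+2) * v (k+2))"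
      using uv_range[of "k+2"] e_pos by (intro mult_left_mono) auto
    moreover have "0 < e^3" using e_pos by simp
    \<comment> \<open>The surplus 150000 e^3 beats the error 130000 e^3, so the e^2 term is strictly
      positive, and the integer J is at least 1.\<close>
    moreover have "0 < E" if "\<bar>P - A - E\<bar> \<le> 130000 * y" "w \<le> P" "w = A + W" "300000 * y * (1/2) \<le> W" "0 < y"
      for P A E y w W :: real using that by linarith
    ultimately have "0 < e^2 * of_int J" by blast
    hence "0 < J" using e_pos by (simp add: zero_less_mult_iff)
    thus "1 \<le> J" by simp
  qed
  \<comment> \<open>A multiple of 11 aligns the window with the period block.\<close>
  define m where "m = 11 * Suc k0"
  have m: "m \<ge> Suc k0" unfolding m_def by simp
  show False
  proof (rule no_admissible_period[of "\<lambda>i. d (m + i)" "\<lambda>i. s (m + i)"])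
    show "d (m + i) = [0,0,1,0,1,1,0,1,1,0,1] ! (i mod 11)" for i
      unfolding d_mod m_def mod_mult_self4 by (rule refl)
    show "even (s (m + i)) \<longleftrightarrow> d (m + i) = 1" for i
      using parity[of "m + i"] even_a[of "m + i"] by simp
    show "\<bar>s (m + i) + s (m + (i + 1))\<bar> \<le> 1" for i
      using adj[of "m + i"] m by (simp add: add.assoc)
    show "admissible (d (m + (i+1))) (d (m + (i+2))) (s (m + i)) (s (m + (i+1))) (s (m + (i+2))) (s (m + (i+3)))" for i
      using adm[of "m + i"] m by (simp add: add.assoc)
  qed
qed

end

section \<open>Expansion of an arbitrary shift\<close>

context ncf begin

text \<open>s_k is taken nearest to z_k / v_k among the integers with the parity of a_k; their
  spacing 2 leaves a remainder z_(k+1) of absolute value at most 1.\<close>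

lemma nearest_expansion:
  "\<exists>s z j. cell R \<alpha> \<gamma> s z j \<and> (\<forall>k. \<bar>z k\<bar> \<le> 1)"
proof -
  define j where "j = round ((1 - \<alpha> + 2 * \<gamma>) / 2)"
  define t where "t k y = a k + 2 * round ((y / v k - of_int (a k)) / 2)" for k and y :: real
  define z where "z = rec_nat (1 - \<alpha> + 2 * \<gamma> - 2 * of_int j) (\<lambda>k y. y / v k - of_int (t k y))"
  have z0: "z 0 = 1 - \<alpha> + 2 * \<gamma> - 2 * of_int j"
    and zS: "z (Suc k) = z k / v k - of_int (t k (z k))" for k by (simp_all add: z_def)
  have rd: "\<bar>y - 2 * of_int (round (y / 2))\<bar> \<le> 1" for y :: real
    using of_int_round_abs_le[of "y / 2"] by linarith
  have "\<bar>z k\<bar> \<le> 1" for k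
  proof (cases k)
    case 0
    thus ?thesis unfolding j_def using rd[of "1 - \<alpha> + 2 * \<gamma>"] by (simp add: z0 j_def)
  next
    case (Suc i)
    thus ?thesis using rd[of "z i / v i - of_int (a i)"] by (simp add: zS t_def algebra_simps)
  qed
  moreover have "cell R \<alpha> \<gamma> (\<lambda>k. t k (z k)) z j"
  proof
    show "even (t k (z k) - a k)" for k by (simp add: t_def)
    show "z k = v k * (of_int (t k (z k)) + z (Suc k))" for k
      using v_bounds(1)[of k] by (simp add: zS)
    show "z 0 = 1 - \<alpha> + 2 * \<gamma> - 2 * of_int j" by (rule z0)
  qed
  ultimately show ?thesis by blast
qed

lemma Mval_le:
  assumes out: "\<not> (\<exists>a b::int. \<gamma> = of_int a + of_int b * \<alpha>)"
  shows "Mval \<alpha> \<gamma> \<le> ereal ((1 - 3 * e + 4 * e^2 + 300000 * e^3) / 4)"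
proof (rule ccontr)
  assume "\<not> ?thesis"
  hence "ereal ((1 - 3 * e + 4 * e^2 + 300000 * e^3) / 4) < Mval \<alpha> \<gamma>" by simp
  from less_LiminfD[OF this[unfolded Mval_def]]
  have fin: "finite {n. \<not> (1 - 3 * e + 4 * e^2 + 300000 * e^3) / 4
      < \<bar>real_of_int n\<bar> * dnint (real_of_int n * \<alpha> - \<gamma>)}"
    by (simp add: eventually_cofinite)
  obtain s z j where c: "cell R \<alpha> \<gamma> s z j" "\<And>k. \<bar>z k\<bar> \<le> 1" using nearest_expansion by blast
  interpret cell R \<alpha> \<gamma> s z j by (rule c(1))
  interpret near_cell R \<alpha> \<gamma> s z j
  proof
    show "\<bar>z k\<bar> \<le> 1" for k by (rule c(2))
    show "\<not> (\<exists>a b::int. \<gamma> = of_int a + of_int b * \<alpha>)" by (rule out)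
    show "finite {n. \<not> (1 - 3 * e + 4 * e^2 + 300000 * e^3) / 4
      \<le> \<bar>real_of_int n\<bar> * dnint (real_of_int n * \<alpha> - \<gamma>)}"
      by (rule finite_subset[OF _ fin]) auto
  qed
  show False by (rule impossible)
qed

end

lemma (in ncf) rho_bounds:
  "ereal ((1 - 3 * e + 4 * e^2 - 300000 * e^3) / 4) \<le> rho \<alpha>"
  "rho \<alpha> \<le> ereal ((1 - 3 * e + 4 * e^2 + 300000 * e^3) / 4)"
proof -
  obtain \<gamma> where \<gamma>: "\<not> (\<exists>a b::int. \<gamma> = of_int a + of_int b * \<alpha>)"
    "ereal ((1 - 3 * e + 4 * e^2 - 300000 * e^3) / 4) \<le> Mval \<alpha> \<gamma>"
    using exists_good_shift by blast
  show "ereal ((1 - 3 * e + 4 * e^2 - 300000 * e^3) / 4) \<le> rho \<alpha>"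
    unfolding rho_def using \<gamma> by (intro SUP_upper2[where i = \<gamma>]) simp_all
  show "rho \<alpha> \<le> ereal ((1 - 3 * e + 4 * e^2 + 300000 * e^3) / 4)"
    unfolding rho_def by (rule SUP_least) (use Mval_le in blast)
qed

theorem theorem3:
  shows "\<exists>C::real. \<exists>R0::int. \<forall>R::int. \<forall>\<alpha>::real.
     odd R \<and> R \<ge> 3 \<and> R \<ge> R0 \<and> 0 < \<alpha> \<and> \<alpha> < 1 \<and>
     (\<forall>n. ncf_digit \<alpha> n = period_block R ! (n mod 11))
     \<longrightarrow> (\<exists>r::real. rho \<alpha> = ereal r \<and>
            \<bar>r - (1/4) * (1 - 3 / real_of_int R + 4 / (real_of_int R)^2)\<bar>
              \<le> C / (real_of_int R)^3)"
\<comment> \<open>75000 = 300000 / 4, the factor 1/4 being that of the main term.\<close>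
proof (rule exI[of _ 75000], rule exI[of _ 1000000], intro allI impI, elim conjE)
  fix R :: int and \<alpha> :: real
  assume "odd R" "R \<ge> 1000000" "0 < \<alpha>" "\<alpha> < 1"
    "\<forall>n. ncf_digit \<alpha> n = period_block R ! (n mod 11)"
  then interpret ncf R \<alpha> by unfold_locales auto
  obtain r where r: "rho \<alpha> = ereal r"
    using rho_bounds by (cases "rho \<alpha>") auto
  have "\<bar>r - 1/4 * (1 - 3 * e + 4 * e^2)\<bar> \<le> 75000 * e^3"
  proof -
    have "\<bar>r - 1/4 * m\<bar> \<le> 75000 * y" if "(m - 300000 * y) / 4 \<le> r" "r \<le> (m + 300000 * y) / 4" for m y
      using that by (simp add: abs_le_iff field_simps)
    thus ?thesis using rho_bounds unfolding r ereal_less_eq by blast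
  qed
  moreover have "3 / real_of_int R = 3 * e" "4 / (real_of_int R)^2 = 4 * e^2" "75000 / (real_of_int R)^3 = 75000 * e^3"
    by (simp_all add: e_def power_divide)
  ultimately show "\<exists>r. rho \<alpha> = ereal r \<and> \<bar>r - 1/4 * (1 - 3 / real_of_int R + 4 / (real_of_int R)^2)\<bar>
      \<le> 75000 / (real_of_int R)^3"
    using r by auto
qed

end
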